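(* Let $n\ge 1$. For each $k\ge1$, $(\bigwedge^kM_n,D_t)$ is an intersection pair. Its intersection ring is $$\mathcal{A}^*\Big(\bigwedge^kM_n,D\Big)=\frac{\mathbb{Z}[D_1,\ldots,D_k]}{(D_{n-k+1},\ldots,D_n)}.$$
   Context: $M=\bigoplus_{i\ge1}\mathbb{Z}\epsilon^i$ is the free $\mathbb{Z}$-module with basis $(\epsilon^1,\epsilon^2,\ldots)$, with endomorphisms $D_j\epsilon^i=\epsilon^{i+j}$ ($j\ge0$). $M_n=M/D_nM$, where $D_nM$ is spanned by $\epsilon^{n+1},\epsilon^{n+2},\ldots$; it is free with basis the images of $\epsilon^1,\ldots,\epsilon^n$ (denoted by the same symbols), and the $D_j$ induce endomorphisms of $M_n$. $D_t=\sum_{j\ge0}D_jt^j$ is extended to $\bigwedge M_n\to(\bigwedge M_n)[[t]]$ by requiring it to be a $\mathbb{Z}$-algebra homomorphism, $D_t(\alpha\wedge\beta)=D_t\alpha\wedge D_t\beta$; its coefficients $D_j$ act on each $\bigwedge^kM_n$ and commute pairwise. Intersection pair: a free $\mathbb{Z}$-module $N$ with a sequence $D=(D_0,D_1,\ldots)$ of pairwise commuting endomorphisms such that for some $m_0\in N$ (a fundamental element) the map $\mathbb{Z}[T_1,T_2,\ldots]\to N$, $P\mapsto P(D_1,D_2,\ldots)m_0$ is surjective. Its intersection ring $\mathcal{A}^*(N,D)$ is the subring $\mathbb{Z}[D]\subseteq\mathrm{End}_{\mathbb{Z}}(N)$ generated by the $D_i$ ($i\ge 1$). In the displayed presentation $D_1,\ldots,D_k$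 are indeterminates (with $D_i$ corresponding to the operator $D_i$), and for $h>k$ the symbol $D_h$ stands for the polynomial in $D_1,\ldots,D_k$ expressing the operator $D_h$ on $\bigwedge^kM$. Explicitly: let $1+\sum_{j\ge1}a_jt^j$ be the formal inverse of $1+\sum_{i\ge1}D_it^i$, so that $a_1,\ldots,a_k$ are polynomials in $D_1,\ldots,D_k$; then $D_h=-\sum_{j=1}^k a_jD_{h-j}$ for $h>k$. Conventions: $D_0=1$, $D_j=0$ for $j<0$. *)

theory Defs
  imports
    "HOL-Library.Poly_Mapping"
    "HOL-Computational_Algebra.Formal_Power_Series"
    "HOL-Computational_Algebra.Group_Closure"
    "HOL-Algebra.Generated_Rings"
    "HOL-Algebra.QuotRing"
    "HOL-Algebra.IntRing"
    "HOL-Algebra.Module"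
begin

section \<open>The exterior algebra of a free abelian group\<close>

text \<open>
  The tensor algebra of the free abelian group with basis \<^typ>\<open>'b\<close> is the monoid ring over the
  integers of the free monoid on \<^typ>\<open>'b\<close>.
\<close>

datatype 'b word = Word (letters: "'b list")

instantiation word :: (type) monoid_add
begin
definition zero_word :: "'b word" where "zero_word = Word []"
definition plus_word :: "'b word \<Rightarrow> 'b word \<Rightarrow> 'b word"
  where "plus_word u v = Word (letters u @ letters v)"
instance by standard (simp_all add: zero_word_def plus_word_def)
end

type_synonym 'b tensor = "'b word \<Rightarrow>\<^sub>0 int"

definition tensor_deg1 :: "'b tensor set" where
  "tensor_deg1 = {v. \<forall>w\<in>Poly_Mapping.keys v. length (letters w) = 1}"

text \<open>The two-sided ideal generated by the squares of the elements of degree one.\<close>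

inductive_set ext_ideal :: "'b tensor set" where
  zero: "0 \<in> ext_ideal"
| square: "v \<in> tensor_deg1 \<Longrightarrow> x * (v * v) * y \<in> ext_ideal"
| add: "s \<in> ext_ideal \<Longrightarrow> t \<in> ext_ideal \<Longrightarrow> s + t \<in> ext_ideal"

lemma ext_ideal_mult: "t \<in> ext_ideal \<Longrightarrow> a * t * b \<in> ext_ideal"
proof (induction rule: ext_ideal.induct)
  case zero
  then show ?case by (simp add: ext_ideal.zero)
next
  case (square v x y)
  then have "(a * x) * (v * v) * (y * b) \<in> ext_ideal" by (rule ext_ideal.square)
  then show ?case by (simp add: mult.assoc)
next
  case (add s t)
  then show ?case by (simp add: distrib_left distrib_right ext_ideal.add)
qed

lemma ext_ideal_mult_left: "t \<in> ext_ideal \<Longrightarrow> a * t \<in> ext_ideal"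
  using ext_ideal_mult[of t a 1] by simp

lemma ext_ideal_mult_right: "t \<in> ext_ideal \<Longrightarrow> t * a \<in> ext_ideal"
  using ext_ideal_mult[of t 1 a] by simp

lemma ext_ideal_uminus: "t \<in> ext_ideal \<Longrightarrow> - t \<in> ext_ideal"
  using ext_ideal_mult_left[of t "-1"] by simp

definition ext_eq :: "'b tensor \<Rightarrow> 'b tensor \<Rightarrow> bool" where
  "ext_eq s t \<longleftrightarrow> s - t \<in> ext_ideal"

lemma equivp_ext_eq: "equivp ext_eq"
proof (rule equivpI)
  show "reflp ext_eq" by (auto intro!: reflpI simp: ext_eq_def ext_ideal.zero)
  show "symp ext_eq"
    by (rule sympI) (metis ext_eq_def ext_ideal_uminus minus_diff_eq)
  show "transp ext_eq"
  proof (rule transpI)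
    fix x y z :: "'b tensor"
    assume "ext_eq x y" "ext_eq y z"
    then have "(x - y) + (y - z) \<in> ext_ideal" unfolding ext_eq_def by (rule ext_ideal.add)
    then show "ext_eq x z" by (simp add: ext_eq_def)
  qed
qed

quotient_type 'b ext_alg = "'b tensor" / ext_eq
  by (rule equivp_ext_eq)

instantiation ext_alg :: (type) ring_1
begin

lift_definition zero_ext_alg :: "'b ext_alg" is 0 .
lift_definition one_ext_alg :: "'b ext_alg" is 1 .

lift_definition plus_ext_alg :: "'b ext_alg \<Rightarrow> 'b ext_alg \<Rightarrow> 'b ext_alg" is "(+)"
  unfolding ext_eq_def by (metis add_diff_add ext_ideal.add)

lift_definition uminus_ext_alg :: "'b ext_alg \<Rightarrow> 'b ext_alg" is uminus
  unfolding ext_eq_def by (metis ext_ideal_uminus minus_diff_minus)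

lift_definition minus_ext_alg :: "'b ext_alg \<Rightarrow> 'b ext_alg \<Rightarrow> 'b ext_alg" is "(-)"
proof -
  fix a b c d :: "'b tensor"
  assume "ext_eq a b" "ext_eq c d"
  then have "(a - b) + - (c - d) \<in> ext_ideal"
    unfolding ext_eq_def by (intro ext_ideal.add ext_ideal_uminus)
  then show "ext_eq (a - c) (b - d)" by (simp add: ext_eq_def algebra_simps)
qed

lift_definition times_ext_alg :: "'b ext_alg \<Rightarrow> 'b ext_alg \<Rightarrow> 'b ext_alg" is "(*)"
proof -
  fix a b c d :: "'b tensor"
  assume "ext_eq a b" "ext_eq c d"
  then have "(a - b) * c + b * (c - d) \<in> ext_ideal"
    unfolding ext_eq_def by (intro ext_ideal.add ext_ideal_mult_left ext_ideal_mult_right)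
  then show "ext_eq (a * c) (b * d)" by (simp add: ext_eq_def algebra_simps)
qed

lemma one_notin_ext_ideal: "1 \<notin> (ext_ideal :: 'b tensor set)"
proof -
  have "Poly_Mapping.lookup t (0 :: 'b word) = 0" if "t \<in> ext_ideal" for t :: "'b tensor"
    using that
  proof (induction rule: ext_ideal.induct)
    case (square v x y)
    have "0 \<notin> Poly_Mapping.keys (x * (v * v) * y)"
    proof
      assume "0 \<in> Poly_Mapping.keys (x * (v * v) * y)"
      then obtain p q where "0 = p + q" "p \<in> Poly_Mapping.keys (x * (v * v))"
        using keys_mult[of "x * (v * v)" y] by blast
      moreover then obtain p' r where "p = p' + r" "r \<in> Poly_Mapping.keys (v * v)"
        using keys_mult[of x "v * v"] by blast
      moreover then obtain r1 r2 where "r = r1 + r2" "r1 \<in> Poly_Mapping.keys v"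
        using keys_mult[of v v] by blast
      ultimately show False
        using square by (auto simp: tensor_deg1_def zero_word_def plus_word_def)
    qed
    then show ?case by (simp add: in_keys_iff)
  qed (simp_all add: lookup_add)
  then show ?thesis by (metis lookup_one_zero zero_neq_one)
qed

instance
proof
  show "(0 :: 'b ext_alg) \<noteq> 1"
  proof transfer
    have "0 - 1 \<notin> (ext_ideal :: 'b tensor set)"
      using one_notin_ext_ideal ext_ideal_uminus[of "- 1 :: 'b tensor"] by auto
    then show "\<not> ext_eq (0 :: 'b tensor) 1" by (simp add: ext_eq_def)
  qed
qed (transfer; simp add: ext_eq_def algebra_simps ext_ideal.zero)+

end

lift_definition ext_gen :: "'b \<Rightarrow> 'b ext_alg"
  is "\<lambda>b. Poly_Mapping.single (Word [b]) 1" .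

text \<open>
  For \<open>B \<subseteq> UNIV\<close> the free group on \<open>B\<close> is a direct summand of the free group on all of \<^typ>\<open>'b\<close>,
  so its exterior algebra is the subring \<open>ext_sub B\<close> below (see \<open>ext_sub_universal\<close>); its
  component of degree \<open>k\<close> is spanned by the \<open>k\<close>-fold products of elements of degree one.
\<close>

definition free_part :: "'b set \<Rightarrow> 'b ext_alg set" where
  "free_part B = group_closure (ext_gen ` B)"

definition ext_power :: "'b set \<Rightarrow> nat \<Rightarrow> 'b ext_alg set" where
  "ext_power B k = group_closure {prod_list vs |vs. length vs = k \<and> set vs \<subseteq> free_part B}"

definition ext_sub :: "'b set \<Rightarrow> 'b ext_alg set" where
  "ext_sub B = group_closure {prod_list vs |vs. set vs \<subseteq> free_part B}"

subsection \<open>Universal property\<close>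

definition tensor_eval :: "('b \<Rightarrow> 'a::ring_1) \<Rightarrow> 'b tensor \<Rightarrow> 'a" where
  "tensor_eval f t =
     (\<Sum>w\<in>Poly_Mapping.keys t. of_int (Poly_Mapping.lookup t w) * prod_list (map f (letters w)))"

definition ext_lift :: "('b \<Rightarrow> 'a::ring_1) \<Rightarrow> 'b ext_alg \<Rightarrow> 'a" where
  "ext_lift f x = tensor_eval f (rep_ext_alg x)"

text \<open>On a basis, this expresses that the square of every linear combination vanishes.\<close>

definition alternating_on_basis :: "('b \<Rightarrow> 'a::ring_1) \<Rightarrow> bool" where
  "alternating_on_basis f \<longleftrightarrow> (\<forall>a. f a * f a = 0) \<and> (\<forall>a b. f a * f b = - (f b * f a))"

lemma tensor_eval_superset:
  assumes "finite S" "Poly_Mapping.keys t \<subseteq> S"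
  shows "tensor_eval f t =
    (\<Sum>w\<in>S. of_int (Poly_Mapping.lookup t w) * prod_list (map f (letters w)))"
  unfolding tensor_eval_def
  by (rule sum.mono_neutral_left) (use assms in \<open>auto simp: in_keys_iff\<close>)

lemma tensor_eval_zero [simp]: "tensor_eval f 0 = 0"
  by (simp add: tensor_eval_def)

lemma tensor_eval_add: "tensor_eval f (s + t) = tensor_eval f s + tensor_eval f t"
proof -
  let ?S = "Poly_Mapping.keys s \<union> Poly_Mapping.keys t"
  have "Poly_Mapping.keys (s + t) \<subseteq> ?S" by (rule Poly_Mapping.keys_add)
  then show ?thesis
    by (simp add: tensor_eval_superset[of ?S] lookup_add distrib_right sum.distrib)
qed

lemma tensor_eval_uminus: "tensor_eval f (- t) = - tensor_eval f t"
  by (metis add_eq_0_iff tensor_eval_add tensor_eval_zero add.right_inverse)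

lemma tensor_eval_diff: "tensor_eval f (s - t) = tensor_eval f s - tensor_eval f t"
  by (metis tensor_eval_add tensor_eval_uminus diff_conv_add_uminus)

lemma tensor_eval_single:
  "tensor_eval f (Poly_Mapping.single w c) = of_int c * prod_list (map f (letters w))"
  by (cases "c = 0") (simp_all add: tensor_eval_def)

lemma tensor_eval_one [simp]: "tensor_eval f 1 = 1"
  unfolding single_one[symmetric] tensor_eval_single by (simp add: zero_word_def)

lemma tensor_eval_sum: "tensor_eval f (\<Sum>i\<in>I. g i) = (\<Sum>i\<in>I. tensor_eval f (g i))"
  by (induction I rule: infinite_finite_induct) (simp_all add: tensor_eval_add)

lemma tensor_as_sum:
  fixes t :: "'b tensor"
  shows "t = (\<Sum>w\<in>Poly_Mapping.keys t. Poly_Mapping.single w (Poly_Mapping.lookup t w))"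
  by (rule poly_mapping_eqI)
     (auto simp: lookup_sum lookup_single when_def in_keys_iff)

lemma tensor_eval_mult_single:
  "tensor_eval f (Poly_Mapping.single u c * Poly_Mapping.single v d)
     = tensor_eval f (Poly_Mapping.single u c) * tensor_eval f (Poly_Mapping.single v d)"
proof -
  let ?U = "prod_list (map f (letters u))" and ?V = "prod_list (map f (letters v))"
  have "of_int (c * d) * (?U * ?V) = of_int c * (of_int d * ?U) * ?V"
    by (simp add: mult.assoc)
  also have "\<dots> = of_int c * (?U * of_int d) * ?V"
    by (simp add: mult_of_int_commute)
  finally show ?thesis
    by (simp add: mult_single tensor_eval_single plus_word_def mult.assoc)
qed

lemma tensor_eval_mult: "tensor_eval f (s * t) = tensor_eval f s * tensor_eval f t"
proof -
  have "tensor_eval f (s * t) = tensor_eval f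
    ((\<Sum>w\<in>Poly_Mapping.keys s. Poly_Mapping.single w (Poly_Mapping.lookup s w)) *
     (\<Sum>w\<in>Poly_Mapping.keys t. Poly_Mapping.single w (Poly_Mapping.lookup t w)))"
    using tensor_as_sum[of s] tensor_as_sum[of t] by simp
  also have "\<dots> = tensor_eval f
      (\<Sum>w\<in>Poly_Mapping.keys s. Poly_Mapping.single w (Poly_Mapping.lookup s w)) *
    tensor_eval f (\<Sum>w\<in>Poly_Mapping.keys t. Poly_Mapping.single w (Poly_Mapping.lookup t w))"
    by (simp add: sum_product tensor_eval_sum tensor_eval_mult_single)
  finally show ?thesis
    using tensor_as_sum[of s] tensor_as_sum[of t] by simp
qed

lemma alternating_square:
  assumes "alternating_on_basis f" "finite A"
  shows "(\<Sum>a\<in>A. of_int (c a) * f a) * (\<Sum>a\<in>A. of_int (c a) * f a) = 0"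
  using assms(2)
proof (induction A rule: finite_induct)
  case (insert x A)
  have sw: "(of_int p * f a) * (of_int q * f b) = of_int (p * q) * (f a * f b)" for p q a b
    by (metis (no_types, lifting) mult.assoc mult_of_int_commute of_int_mult)
  have anti: "(of_int (c x) * f x) * (of_int (c a) * f a)
      = - ((of_int (c a) * f a) * (of_int (c x) * f x))" for a
    using assms(1) unfolding sw alternating_on_basis_def
    by (metis minus_mult_right mult.commute)
  have "(of_int (c x) * f x) * (\<Sum>a\<in>A. of_int (c a) * f a)
      = - ((\<Sum>a\<in>A. of_int (c a) * f a) * (of_int (c x) * f x))"
    unfolding sum_distrib_left sum_distrib_right anti by (rule sum_negf)
  moreover have "(of_int (c x) * f x) * (of_int (c x) * f x) = 0"
    using assms(1) unfolding sw alternating_on_basis_def by simp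
  ultimately show ?case
    using insert by (simp add: distrib_left distrib_right)
qed simp

lemma tensor_eval_ideal:
  assumes "alternating_on_basis f" "t \<in> ext_ideal"
  shows "tensor_eval f t = 0"
  using assms(2)
proof (induction rule: ext_ideal.induct)
  case (square v x y)
  have "tensor_eval f v =
    (\<Sum>a\<in>(\<lambda>w. hd (letters w)) ` Poly_Mapping.keys v.
       of_int (Poly_Mapping.lookup v (Word [a])) * f a)"
  proof -
    have w: "w = Word [hd (letters w)]" if "w \<in> Poly_Mapping.keys v" for w
    proof -
      have "length (letters w) = 1" using square that by (auto simp: tensor_deg1_def)
      then show ?thesis by (cases w) (auto simp: length_Suc_conv)
    qed
    have "inj_on (\<lambda>w. hd (letters w)) (Poly_Mapping.keys v)"
      by (rule inj_onI) (metis w)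
    moreover have "prod_list (map f (letters w)) = f (hd (letters w))"
      if "w \<in> Poly_Mapping.keys v" for w
      by (subst w[OF that]) simp
    ultimately show ?thesis
      unfolding tensor_eval_def
      by (simp add: sum.reindex w[symmetric] cong: sum.cong)
  qed
  then have "tensor_eval f v * tensor_eval f v = 0"
    using alternating_square[OF assms(1)] by simp
  then show ?case by (simp add: tensor_eval_mult)
qed (simp_all add: tensor_eval_add)

lemma ext_lift_abs:
  assumes "alternating_on_basis f"
  shows "ext_lift f (abs_ext_alg t) = tensor_eval f t"
proof -
  have "ext_eq (rep_ext_alg (abs_ext_alg t)) t"
    by (simp add: Quotient3_ext_alg rep_abs_rsp_left equivp_reflp[OF equivp_ext_eq])
  then have "tensor_eval f (rep_ext_alg (abs_ext_alg t) - t) = 0"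
    unfolding ext_eq_def by (rule tensor_eval_ideal[OF assms])
  then show ?thesis by (simp add: ext_lift_def tensor_eval_diff)
qed

lemma abs_ext_alg_surj: "\<exists>t. x = abs_ext_alg t"
  by (metis Quotient3_abs_rep Quotient3_ext_alg)

lemma ext_lift_hom:
  assumes "alternating_on_basis f"
  shows ext_lift_zero: "ext_lift f 0 = 0"
    and ext_lift_one: "ext_lift f 1 = 1"
    and ext_lift_add: "ext_lift f (x + y) = ext_lift f x + ext_lift f y"
    and ext_lift_diff: "ext_lift f (x - y) = ext_lift f x - ext_lift f y"
    and ext_lift_mult: "ext_lift f (x * y) = ext_lift f x * ext_lift f y"
    and ext_lift_gen: "ext_lift f (ext_gen b) = f b"
proof -
  obtain s t where x: "x = abs_ext_alg s" and y: "y = abs_ext_alg t"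
    using abs_ext_alg_surj by blast
  show "ext_lift f 0 = 0" "ext_lift f 1 = 1"
    by (simp_all add: zero_ext_alg.abs_eq one_ext_alg.abs_eq ext_lift_abs[OF assms])
  show "ext_lift f (x + y) = ext_lift f x + ext_lift f y"
    "ext_lift f (x - y) = ext_lift f x - ext_lift f y"
    "ext_lift f (x * y) = ext_lift f x * ext_lift f y"
    unfolding x y
    by (simp_all add: plus_ext_alg.abs_eq minus_ext_alg.abs_eq times_ext_alg.abs_eq
        ext_lift_abs[OF assms] tensor_eval_add tensor_eval_diff tensor_eval_mult)
  show "ext_lift f (ext_gen b) = f b"
    by (simp add: ext_gen.abs_eq ext_lift_abs[OF assms] tensor_eval_single)
qed

definition hom_on_ext_sub :: "'b set \<Rightarrow> ('b ext_alg \<Rightarrow> 'a::ring_1) \<Rightarrow> bool" where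
  "hom_on_ext_sub B \<phi> \<longleftrightarrow> \<phi> 1 = 1 \<and>
     (\<forall>x\<in>ext_sub B. \<forall>y\<in>ext_sub B. \<phi> (x + y) = \<phi> x + \<phi> y \<and> \<phi> (x * y) = \<phi> x * \<phi> y)"

lemma ext_sub_prod: "set vs \<subseteq> free_part B \<Longrightarrow> prod_list vs \<in> ext_sub B"
  unfolding ext_sub_def by (rule group_closure.base) auto

lemma free_part_ext_sub: "v \<in> free_part B \<Longrightarrow> v \<in> ext_sub B"
  using ext_sub_prod[of "[v]" B] by simp

lemma hom_on_ext_sub_unique:
  assumes hom: "hom_on_ext_sub B \<phi>" "hom_on_ext_sub B \<psi>"
    and gen: "\<And>b. b \<in> B \<Longrightarrow> \<phi> (ext_gen b) = \<psi> (ext_gen b)"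
    and x: "x \<in> ext_sub B"
  shows "\<phi> x = \<psi> x"
proof -
  have "0 \<in> ext_sub B" unfolding ext_sub_def by simp
  then have "\<phi> (0 + 0) = \<phi> 0 + \<phi> 0" "\<psi> (0 + 0) = \<psi> 0 + \<psi> 0"
    using hom unfolding hom_on_ext_sub_def by blast+
  then have zero: "\<phi> 0 = 0" "\<psi> 0 = 0" by simp_all
  have hom_diff: "\<phi> (x - y) = \<phi> x - \<phi> y" "\<psi> (x - y) = \<psi> x - \<psi> y"
    if "x \<in> ext_sub B" "y \<in> ext_sub B" for x y
  proof -
    have "x - y \<in> ext_sub B" using that unfolding ext_sub_def by (rule group_closure.diff)
    then have "\<phi> (x - y + y) = \<phi> (x - y) + \<phi> y" "\<psi> (x - y + y) = \<psi> (x - y) + \<psi> y"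
      using that hom unfolding hom_on_ext_sub_def by blast+
    then show "\<phi> (x - y) = \<phi> x - \<phi> y" "\<psi> (x - y) = \<psi> x - \<psi> y" by simp_all
  qed
  have v: "\<phi> v = \<psi> v" if "v \<in> free_part B" for v
    using that unfolding free_part_def
  proof (induction rule: group_closure.induct)
    case (base s)
    then show ?case using gen zero by auto
  next
    case (diff s t)
    then have "s \<in> ext_sub B" "t \<in> ext_sub B"
      by (auto intro!: free_part_ext_sub simp: free_part_def)
    then show ?case by (simp only: hom_diff diff.IH)
  qed
  have p: "\<phi> (prod_list vs) = \<psi> (prod_list vs)" if "set vs \<subseteq> free_part B" for vs
    using that
  proof (induction vs)
    case Nil
    then show ?case using hom by (simp add: hom_on_ext_sub_def)
  next
    case (Cons a vs)
    then have "a \<in> ext_sub B" "prod_list vs \<in> ext_sub B"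
      by (auto intro: free_part_ext_sub ext_sub_prod)
    then show ?case using hom Cons v by (simp add: hom_on_ext_sub_def)
  qed
  show ?thesis
    using x unfolding ext_sub_def
  proof (induction rule: group_closure.induct)
    case (base s)
    then show ?case using p zero by auto
  next
    case (diff s t)
    then have "s \<in> ext_sub B" "t \<in> ext_sub B" by (auto simp: ext_sub_def)
    then show ?case by (simp only: hom_diff diff.IH)
  qed
qed

lemma ext_sub_universal:
  fixes f :: "'b \<Rightarrow> 'a::ring_1"
  assumes "\<And>a. a \<in> B \<Longrightarrow> f a * f a = 0"
    and "\<And>a b. a \<in> B \<Longrightarrow> b \<in> B \<Longrightarrow> f a * f b = - (f b * f a)"
  shows "\<exists>\<phi>. hom_on_ext_sub B \<phi> \<and> (\<forall>b\<in>B. \<phi> (ext_gen b) = f b)"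
proof -
  have alt: "alternating_on_basis (\<lambda>b. if b \<in> B then f b else 0)"
    unfolding alternating_on_basis_def
  proof (intro conjI allI)
    fix a b
    show "(if a \<in> B then f a else 0) * (if a \<in> B then f a else 0) = 0"
      using assms(1)[of a] by simp
    show "(if a \<in> B then f a else 0) * (if b \<in> B then f b else 0)
        = - ((if b \<in> B then f b else 0) * (if a \<in> B then f a else 0))"
    proof (cases "a \<in> B \<and> b \<in> B")
      case True
      then show ?thesis by (simp only: if_True) (rule assms(2); simp)
    qed auto
  qed
  show ?thesis
    by (rule exI[of _ "ext_lift (\<lambda>b. if b \<in> B then f b else 0)"])
       (simp add: hom_on_ext_sub_def ext_lift_hom[OF alt])
qed

lemma tensor_deg1_single: "Poly_Mapping.single (Word [b]) c \<in> tensor_deg1"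
  by (cases "c = 0") (auto simp: tensor_deg1_def)

lemma ext_gen_square: "ext_gen b * ext_gen b = 0"
proof transfer
  fix b :: 'b
  let ?v = "Poly_Mapping.single (Word [b]) (1::int)"
  have "1 * (?v * ?v) * 1 \<in> ext_ideal"
    by (rule ext_ideal.square) (rule tensor_deg1_single)
  then show "ext_eq (?v * ?v) 0" by (simp add: ext_eq_def)
qed

lemma ext_gen_anti: "ext_gen a * ext_gen b = - (ext_gen b * ext_gen a)"
proof -
  have "(ext_gen a + ext_gen b) * (ext_gen a + ext_gen b) = 0"
  proof transfer
    fix a b :: 'b
    let ?v = "Poly_Mapping.single (Word [a]) (1::int) + Poly_Mapping.single (Word [b]) 1"
    have "?v \<in> tensor_deg1"
      using Poly_Mapping.keys_add[of "Poly_Mapping.single (Word [a]) (1::int)"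
          "Poly_Mapping.single (Word [b]) 1"]
      by (auto simp: tensor_deg1_def)
    then have "1 * (?v * ?v) * 1 \<in> ext_ideal" by (rule ext_ideal.square)
    then show "ext_eq (?v * ?v) 0" by (simp add: ext_eq_def)
  qed
  then show ?thesis
    by (simp add: distrib_left distrib_right ext_gen_square add_eq_0_iff2)
qed

section \<open>The derivation of the exterior algebra of \<open>M\<^sub>n\<close>\<close>

text \<open>
  \<open>M\<^sub>n\<close> is the free group on \<open>\<epsilon>\<^sup>1, \<dots>, \<epsilon>\<^sup>n\<close>, that is \<open>free_part {1..n}\<close> inside \<^typ>\<open>nat ext_alg\<close>;
  passing from \<open>M\<close> to \<open>M\<^sub>n\<close> amounts to \<open>\<epsilon>\<^sup>i = 0\<close> for \<open>i > n\<close>.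
\<close>

definition D_basis :: "nat \<Rightarrow> nat \<Rightarrow> nat ext_alg fps" where
  "D_basis n i = Abs_fps (\<lambda>j. if 1 \<le> i \<and> i + j \<le> n then ext_gen (i + j) else 0)"

definition D_t :: "nat \<Rightarrow> nat ext_alg \<Rightarrow> nat ext_alg fps" where
  "D_t n = ext_lift (D_basis n)"

definition D_op :: "nat \<Rightarrow> nat \<Rightarrow> nat ext_alg \<Rightarrow> nat ext_alg" where
  "D_op n j x = fps_nth (D_t n x) j"

lemma alternating_D_basis: "alternating_on_basis (D_basis n)"
  unfolding alternating_on_basis_def
proof (intro conjI allI)
  fix a b
  define g where "g = (\<lambda>a j. if 1 \<le> a \<and> a + j \<le> n then ext_gen (a + j :: nat) else 0)"
  have nth: "fps_nth (D_basis n a) j = g a j" for a j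
    by (simp add: D_basis_def g_def)
  have anti: "g a i * g b j = - (g b j * g a i)" for a b i j
    using ext_gen_anti by (auto simp: g_def)
  have sq: "g a i * g a i = 0" for a i
    by (simp add: g_def ext_gen_square)
  show "D_basis n a * D_basis n b = - (D_basis n b * D_basis n a)"
  proof (rule fps_ext)
    fix m :: nat
    have "(\<Sum>i=0..m. g a i * g b (m - i)) = (\<Sum>i=0..m. g a (m - i) * g b i)"
      by (rule sum.reindex_bij_witness[of _ "\<lambda>i. m - i" "\<lambda>i. m - i"]) auto
    also have "\<dots> = - (\<Sum>i=0..m. g b i * g a (m - i))"
      by (subst anti) (rule sum_negf)
    finally show "fps_nth (D_basis n a * D_basis n b) m
        = fps_nth (- (D_basis n b * D_basis n a)) m"
      by (simp add: fps_mult_nth nth)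
  qed
  show "D_basis n a * D_basis n a = 0"
  proof (rule fps_ext)
    fix m :: nat
    let ?L = "{i\<in>{0..m}. 2 * i < m}" and ?E = "{i\<in>{0..m}. 2 * i = m}"
      and ?G = "{i\<in>{0..m}. 2 * i > m}"
    have "(\<Sum>i\<in>?G. g a i * g a (m - i)) = (\<Sum>i\<in>?L. g a (m - i) * g a i)"
      by (rule sum.reindex_bij_witness[of _ "\<lambda>i. m - i" "\<lambda>i. m - i"]) auto
    also have "\<dots> = - (\<Sum>i\<in>?L. g a i * g a (m - i))"
      by (subst anti) (rule sum_negf)
    finally have LG: "(\<Sum>i\<in>?L. g a i * g a (m - i)) + (\<Sum>i\<in>?G. g a i * g a (m - i)) = 0"
      by simp
    have E: "(\<Sum>i\<in>?E. g a i * g a (m - i)) = 0"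
    proof (rule sum.neutral, rule ballI)
      fix i assume "i \<in> ?E"
      then have "m - i = i" by auto
      then show "g a i * g a (m - i) = 0" by (simp add: sq)
    qed
    have "{0..m} = (?L \<union> ?G) \<union> ?E" by auto
    then have "(\<Sum>i=0..m. g a i * g a (m - i)) = (\<Sum>i\<in>(?L \<union> ?G) \<union> ?E. g a i * g a (m - i))"
      by (rule sum.cong[OF _ refl])
    also have "\<dots> = (\<Sum>i\<in>?L \<union> ?G. g a i * g a (m - i)) + (\<Sum>i\<in>?E. g a i * g a (m - i))"
      by (rule sum.union_disjoint) auto
    also have "(\<Sum>i\<in>?L \<union> ?G. g a i * g a (m - i))
        = (\<Sum>i\<in>?L. g a i * g a (m - i)) + (\<Sum>i\<in>?G. g a i * g a (m - i))"
      by (rule sum.union_disjoint) auto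
    finally show "fps_nth (D_basis n a * D_basis n a) m = fps_nth 0 m"
      using LG E by (simp add: fps_mult_nth nth)
  qed
qed

lemma D_t_one: "D_t n 1 = 1"
  and D_t_add: "D_t n (x + y) = D_t n x + D_t n y"
  and D_t_mult: "D_t n (x * y) = D_t n x * D_t n y"
  and D_t_gen: "D_t n (ext_gen i) = D_basis n i"
  unfolding D_t_def by (rule ext_lift_hom[OF alternating_D_basis])+

lemma D_t_unique:
  assumes "hom_on_ext_sub {1..n} E" "\<And>i. i \<in> {1..n} \<Longrightarrow> E (ext_gen i) = D_basis n i"
    and "x \<in> ext_sub {1..n}"
  shows "E x = D_t n x"
  by (rule hom_on_ext_sub_unique[OF assms(1) _ _ assms(3)])
     (simp_all add: hom_on_ext_sub_def D_t_one D_t_add D_t_mult D_t_gen assms)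

text \<open>
  Modules are records extending \<^typ>\<open>'a ring\<close>; as usual in HOL-Algebra, the fields \<open>mult\<close> and
  \<open>one\<close> of a module carry no meaning.
\<close>

definition ext_power_module :: "nat \<Rightarrow> nat \<Rightarrow> (int, nat ext_alg) module" where
  "ext_power_module n k =
     \<lparr>carrier = ext_power {1..n} k, mult = (*), one = 1, zero = 0, add = (+),
      smult = (\<lambda>c x. of_int c * x)\<rparr>"

section \<open>Integer polynomials\<close>

type_synonym int_mpoly = "(nat \<Rightarrow>\<^sub>0 nat) \<Rightarrow>\<^sub>0 int"

definition mvar :: "nat \<Rightarrow> int_mpoly" where
  "mvar i = Poly_Mapping.single (Poly_Mapping.single i 1) 1"

definition int_mpoly_ring :: "nat set \<Rightarrow> int_mpoly ring" where
  "int_mpoly_ring V =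
     \<lparr>carrier = {p. \<forall>m\<in>Poly_Mapping.keys p. Poly_Mapping.keys m \<subseteq> V},
      mult = (*), one = 1, zero = 0, add = (+)\<rparr>"

section \<open>Intersection pairs\<close>

text \<open>
  \<open>poly_apply N D P x\<close> is \<open>P(D) x\<close>. The operators are applied in order of increasing index, which
  is immaterial when they commute.
\<close>

definition monom_apply :: "(nat \<Rightarrow> 'a \<Rightarrow> 'a) \<Rightarrow> (nat \<Rightarrow>\<^sub>0 nat) \<Rightarrow> 'a \<Rightarrow> 'a" where
  "monom_apply D m x =
     fold (\<lambda>i. (D i) ^^ (Poly_Mapping.lookup m i)) (sorted_list_of_set (Poly_Mapping.keys m)) x"

definition poly_apply ::
  "(int, 'a, 'm) module_scheme \<Rightarrow> (nat \<Rightarrow> 'a \<Rightarrow> 'a) \<Rightarrow> int_mpoly \<Rightarrow> 'a \<Rightarrow> 'a" where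
  "poly_apply N D P x =
     (\<Oplus>\<^bsub>N\<^esub>m\<in>Poly_Mapping.keys P. Poly_Mapping.lookup P m \<odot>\<^bsub>N\<^esub> monom_apply D m x)"

definition is_Z_basis :: "(int, 'a, 'm) module_scheme \<Rightarrow> 'a set \<Rightarrow> bool" where
  "is_Z_basis N B \<longleftrightarrow> B \<subseteq> carrier N \<and>
     (\<forall>x\<in>carrier N. \<exists>!c :: 'a \<Rightarrow>\<^sub>0 int. Poly_Mapping.keys c \<subseteq> B \<and>
        x = (\<Oplus>\<^bsub>N\<^esub>b\<in>Poly_Mapping.keys c. Poly_Mapping.lookup c b \<odot>\<^bsub>N\<^esub> b))"

definition free_Z_module :: "(int, 'a, 'm) module_scheme \<Rightarrow> bool" where
  "free_Z_module N \<longleftrightarrow> module \<Z> N \<and> (\<exists>B. is_Z_basis N B)"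

definition fundamental_element ::
  "(int, 'a, 'm) module_scheme \<Rightarrow> (nat \<Rightarrow> 'a \<Rightarrow> 'a) \<Rightarrow> 'a \<Rightarrow> bool" where
  "fundamental_element N D m0 \<longleftrightarrow> m0 \<in> carrier N \<and>
     (\<lambda>P. poly_apply N D P m0) ` carrier (int_mpoly_ring {1..}) = carrier N"

text \<open>Additive maps between integer modules are linear.\<close>

definition intersection_pair ::
  "(int, 'a, 'm) module_scheme \<Rightarrow> (nat \<Rightarrow> 'a \<Rightarrow> 'a) \<Rightarrow> bool" where
  "intersection_pair N D \<longleftrightarrow>
     free_Z_module N \<and>
     (\<forall>i. D i \<in> hom (add_monoid N) (add_monoid N)) \<and>
     (\<forall>i j. \<forall>x\<in>carrier N. D i (D j x) = D j (D i x)) \<and>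
     (\<exists>m0. fundamental_element N D m0)"

text \<open>
  Endomorphisms are represented by functions that are undefined off the carrier, so that equality
  of functions is equality of endomorphisms.
\<close>

definition End_ring :: "(int, 'a, 'm) module_scheme \<Rightarrow> ('a \<Rightarrow> 'a) ring" where
  "End_ring N =
     \<lparr>carrier = hom (add_monoid N) (add_monoid N) \<inter> extensional (carrier N),
      mult = compose (carrier N),
      one = (\<lambda>x\<in>carrier N. x),
      zero = (\<lambda>x\<in>carrier N. \<zero>\<^bsub>N\<^esub>),
      add = (\<lambda>f g. \<lambda>x\<in>carrier N. f x \<oplus>\<^bsub>N\<^esub> g x)\<rparr>"

definition intersection_ring ::
  "(int, 'a, 'm) module_scheme \<Rightarrow> (nat \<Rightarrow> 'a \<Rightarrow> 'a) \<Rightarrow> ('a \<Rightarrow> 'a) ring" where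
  "intersection_ring N D =
     (End_ring N)\<lparr>carrier :=
        generate_ring (End_ring N) {restrict (D i) (carrier N) |i. 1 \<le> i}\<rparr>"

section \<open>The presentation\<close>

text \<open>
  \<open>D_inv j\<close> is the coefficient \<open>a\<^sub>j\<close> of the formal inverse of \<open>1 + \<Sum>\<^sub>i D\<^sub>i t\<^sup>i\<close> with indeterminates
  \<open>D\<^sub>i\<close>; it only involves \<open>D\<^sub>1, \<dots>, D\<^sub>j\<close>.
\<close>

definition D_gen_series :: "int_mpoly fps" where
  "D_gen_series = Abs_fps (\<lambda>i. if i = 0 then 1 else mvar i)"

definition D_inv :: "nat \<Rightarrow> int_mpoly" where
  "D_inv j = fps_nth (fps_right_inverse D_gen_series 1) j"

lemma D_gen_series_inverse: "D_gen_series * Abs_fps D_inv = 1"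
proof -
  have "D_gen_series * fps_right_inverse D_gen_series 1 = 1"
    by (rule fps_right_inverse) (simp add: D_gen_series_def)
  moreover have "Abs_fps D_inv = fps_right_inverse D_gen_series 1"
    by (simp add: fps_eq_iff D_inv_def)
  ultimately show ?thesis by simp
qed

function D_sym :: "nat \<Rightarrow> int \<Rightarrow> int_mpoly" where
  "D_sym k h =
     (if h < 0 then 0
      else if h = 0 then 1
      else if h \<le> int k then mvar (nat h)
      else - (\<Sum>j=1..k. D_inv j * D_sym k (h - int j)))"
  by auto
termination
  by (relation "measure (\<lambda>(k, h). nat h)") auto

declare D_sym.simps [simp del]

text \<open>
  The index \<open>n - k + 1\<close> is an integer: for \<open>k > n\<close> the generators include \<open>D\<^sub>0 = 1\<close>.
\<close>

definition D_ideal :: "nat \<Rightarrow> nat \<Rightarrow> int_mpoly set" where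
  "D_ideal n k = Idl\<^bsub>int_mpoly_ring {1..k}\<^esub> (D_sym k ` {int n - int k + 1..int n})"

end

theory Submission
  imports Defs "Jordan_Normal_Form.Determinant"
begin

text \<open>
  The evaluation \<open>P \<mapsto> P(D) m\<^sub>0\<close> at \<open>m\<^sub>0 = \<epsilon>\<^sup>1 \<and> \<dots> \<and> \<epsilon>\<^sup>k\<close> maps the polynomial ring
  \<open>A = \<int>[D\<^sub>1, \<dots>, D\<^sub>k]\<close> onto \<open>N = \<And>\<^sup>k M\<^sub>n\<close>, and its kernel is the ideal
  \<open>J = (D\<^sub>n\<^sub>-\<^sub>k\<^sub>+\<^sub>1, \<dots>, D\<^sub>n)\<close>. Since the operators commute and \<open>m\<^sub>0\<close> generates \<open>N\<close>, a polynomial that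
  kills \<open>m\<^sub>0\<close> kills all of \<open>N\<close>; so the kernel of \<open>A \<rightarrow> End N\<close> is \<open>J\<close> as well, and its image is the
  intersection ring.

  Three facts carry this. The first is surjectivity (\<open>fundamental_generates\<close>). From
  \<open>D\<^sub>t \<epsilon>\<^sup>i = \<epsilon>\<^sup>i + t D\<^sub>t \<epsilon>\<^sup>i\<^sup>+\<^sup>1\<close> one gets the integration by parts
  \<open>D\<^sub>h x \<and> \<epsilon>\<^sup>i = D\<^sub>h (x \<and> \<epsilon>\<^sup>i) - D\<^sub>h\<^sub>-\<^sub>1 (x \<and> \<epsilon>\<^sup>i\<^sup>+\<^sup>1)\<close>, which reduces the claim for \<open>k\<close> factors to
  that for \<open>k - 1\<close> factors, and \<open>D\<^sub>h m\<^sub>0 = \<epsilon>\<^sup>1 \<and> \<dots> \<and> \<epsilon>\<^sup>k\<^sup>-\<^sup>1 \<and> \<epsilon>\<^sup>k\<^sup>+\<^sup>h\<close>, which starts the reduction and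
  also shows that \<open>D\<^sub>h\<close> vanishes on \<open>N\<close> for \<open>h > n - k\<close>.

  The second is that \<open>D\<^sub>1, \<dots>, D\<^sub>k\<close> suffice (\<open>op_poly_D_sym\<close>). The inverse of \<open>D\<^sub>t\<close> sends each \<open>\<epsilon>\<^sup>i\<close>
  to \<open>\<epsilon>\<^sup>i - t \<epsilon>\<^sup>i\<^sup>+\<^sup>1\<close>, so it has degree at most \<open>k\<close> in \<open>t\<close> on products of \<open>k\<close> factors, and
  \<open>D\<^sub>h\<close> satisfies a linear recursion of order \<open>k\<close>.

  The third is that the kernel is no larger than \<open>J\<close> (\<open>annihilator_fundamental_subset\<close>). Giambelli's
  determinant \<open>\<epsilon>\<^bsup>i(1)\<^esup> \<and> \<dots> \<and> \<epsilon>\<^bsup>i(k)\<^esup> \<mapsto> det (D\<^bsub>i(a)-b\<^esub>)\<close> defines an additive map \<open>\<psi>\<close> from \<open>N\<close> to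
  \<open>A\<close> with \<open>\<psi>(m\<^sub>0) = 1\<close>. The recursion says that the rows \<open>r(i) = (D\<^sub>i\<^sub>-\<^sub>1, \<dots>, D\<^sub>i\<^sub>-\<^sub>k)\<close> satisfy
  \<open>r(i + 1) = r(i) C\<close> for a fixed matrix \<open>C\<close>. Hence applying \<open>D\<^sub>t\<close> to a product multiplies its
  determinant by \<open>det (1 - t C)\<^sup>-\<^sup>1\<close>, and evaluating at \<open>m\<^sub>0\<close> identifies this factor as
  \<open>\<Sum>\<^sub>j D\<^sub>j t\<^sup>j\<close> (\<open>giambelli_pieri\<close>). Products with a factor \<open>\<epsilon>\<^sup>i\<close>, \<open>i > n\<close>, vanish in \<open>N\<close> and have
  determinants in \<open>J\<close>. So \<open>\<psi>(P(D) m\<^sub>0) \<equiv> P\<close> modulo \<open>J\<close>, and \<open>P(D) m\<^sub>0 = 0\<close> forces \<open>P \<in> J\<close>.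

  Freeness of \<open>N\<close> is obtained from determinants too: the linear forms dual to the increasing products
  are determinants of \<open>0\<close>-\<open>1\<close> matrices.
\<close>

section \<open>Additive maps out of the exterior algebra\<close>

lemma group_closure_sum:
  "(\<And>i. i \<in> I \<Longrightarrow> f i \<in> group_closure S) \<Longrightarrow> (\<Sum>i\<in>I. f i) \<in> group_closure S"
  by (induction I rule: infinite_finite_induct) (auto intro: group_closure_add)

lemma group_closure_mono:
  assumes "S \<subseteq> group_closure T" shows "group_closure S \<subseteq> group_closure T"
proof
  fix x assume "x \<in> group_closure S"
  then show "x \<in> group_closure T"
    by (induction rule: group_closure.induct) (use assms in \<open>auto intro: group_closure.diff\<close>)
qed

lemma group_closure_of_int:
  fixes x :: "'a::ring_1"
  assumes "x \<in> group_closure S" shows "of_int c * x \<in> group_closure S"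
proof (induction c rule: int_induct[where k = 0])
  case (step1 i)
  then show ?case using assms by (simp add: distrib_right group_closure_add)
next
  case (step2 i)
  then show ?case using assms by (simp add: left_diff_distrib group_closure.diff)
qed simp

text \<open>
  The words in the generators span the exterior algebra, so an additive identity on it need only
  be checked on them.
\<close>

lemma abs_ext_alg_sum: "abs_ext_alg (\<Sum>i\<in>I. f i) = (\<Sum>i\<in>I. abs_ext_alg (f i))"
  by (induction I rule: infinite_finite_induct)
     (simp_all add: zero_ext_alg.abs_eq[symmetric] plus_ext_alg.abs_eq[symmetric])

lemma abs_ext_alg_word: "abs_ext_alg (Poly_Mapping.single (Word xs) 1) = prod_list (map ext_gen xs)"
proof (induction xs)
  case Nil
  then show ?case by (simp add: one_ext_alg.abs_eq single_one[symmetric] zero_word_def)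
next
  case (Cons a xs)
  have "Poly_Mapping.single (Word (a # xs)) (1::int)
      = Poly_Mapping.single (Word [a]) 1 * Poly_Mapping.single (Word xs) 1"
    by (simp add: mult_single plus_word_def)
  then show ?case
    by (simp add: Cons.IH ext_gen.abs_eq times_ext_alg.abs_eq[symmetric])
qed

lemma abs_ext_alg_single:
  "abs_ext_alg (Poly_Mapping.single (Word xs) c) = of_int c * prod_list (map ext_gen xs)"
proof (induction c rule: int_induct[where k = 0])
  case base
  then show ?case by (simp add: zero_ext_alg.abs_eq[symmetric])
next
  case (step1 i)
  then show ?case
    by (simp add: single_add plus_ext_alg.abs_eq[symmetric] abs_ext_alg_word distrib_right)
next
  case (step2 i)
  then show ?case
    by (simp add: single_diff minus_ext_alg.abs_eq[symmetric] abs_ext_alg_word left_diff_distrib)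
qed

lemma ext_alg_spanned: "x \<in> group_closure (range (\<lambda>xs. prod_list (map ext_gen xs)))"
proof -
  obtain t where x: "x = abs_ext_alg t" using abs_ext_alg_surj by blast
  have "x = (\<Sum>w\<in>Poly_Mapping.keys t. abs_ext_alg (Poly_Mapping.single w (Poly_Mapping.lookup t w)))"
    unfolding x abs_ext_alg_sum[symmetric] using tensor_as_sum[of t] by simp
  also have "\<dots> \<in> group_closure (range (\<lambda>xs. prod_list (map ext_gen xs)))"
  proof (rule group_closure_sum)
    fix w
    show "abs_ext_alg (Poly_Mapping.single w (Poly_Mapping.lookup t w))
        \<in> group_closure (range (\<lambda>xs. prod_list (map ext_gen xs)))"
      by (cases w) (auto simp: abs_ext_alg_single intro!: group_closure_of_int intro: group_closure.base)
  qed
  finally show ?thesis .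
qed

lemma ext_alg_induct [case_names diff word]:
  assumes "\<And>x y. P x \<Longrightarrow> P y \<Longrightarrow> P (x - y)" and "\<And>xs. P (prod_list (map ext_gen xs))"
  shows "P x"
  using ext_alg_spanned[of x]
proof (induction rule: group_closure.induct)
  case (base s)
  have "P (prod_list (map ext_gen []) - prod_list (map ext_gen []))" by (intro assms)
  then show ?case using base assms(2) by auto
qed (rule assms(1))

text \<open>
  Transposing two adjacent letters suffices for antisymmetry, and the vanishing on a repeated pair
  does not follow from it when \<open>2\<close> is a zero divisor.
\<close>

definition alternating_on_words :: "('b list \<Rightarrow> 'a::ring_1) \<Rightarrow> bool" where
  "alternating_on_words F \<longleftrightarrow>
     (\<forall>xs a ys. F (xs @ [a, a] @ ys) = 0) \<and>
     (\<forall>xs a b ys. F (xs @ [a, b] @ ys) = - F (xs @ [b, a] @ ys))"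

definition tensor_lin :: "('b list \<Rightarrow> 'a::ring_1) \<Rightarrow> 'b tensor \<Rightarrow> 'a" where
  "tensor_lin F t = (\<Sum>w\<in>Poly_Mapping.keys t. of_int (Poly_Mapping.lookup t w) * F (letters w))"

definition ext_lin :: "('b list \<Rightarrow> 'a::ring_1) \<Rightarrow> 'b ext_alg \<Rightarrow> 'a" where
  "ext_lin F x = tensor_lin F (rep_ext_alg x)"

lemma tensor_lin_superset:
  assumes "finite S" "Poly_Mapping.keys t \<subseteq> S"
  shows "tensor_lin F t = (\<Sum>w\<in>S. of_int (Poly_Mapping.lookup t w) * F (letters w))"
  unfolding tensor_lin_def
  by (rule sum.mono_neutral_left) (use assms in \<open>auto simp: in_keys_iff\<close>)

lemma tensor_lin_zero [simp]: "tensor_lin F 0 = 0"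
  by (simp add: tensor_lin_def)

lemma tensor_lin_add: "tensor_lin F (s + t) = tensor_lin F s + tensor_lin F t"
proof -
  let ?S = "Poly_Mapping.keys s \<union> Poly_Mapping.keys t"
  have "Poly_Mapping.keys (s + t) \<subseteq> ?S" by (rule Poly_Mapping.keys_add)
  then show ?thesis
    by (simp add: tensor_lin_superset[of ?S] lookup_add distrib_right sum.distrib)
qed

lemma tensor_lin_diff: "tensor_lin F (s - t) = tensor_lin F s - tensor_lin F t"
  by (metis tensor_lin_add add_diff_cancel_right' diff_add_cancel)

lemma tensor_lin_single: "tensor_lin F (Poly_Mapping.single w c) = of_int c * F (letters w)"
  by (cases "c = 0") (simp_all add: tensor_lin_def)

lemma tensor_lin_sum: "tensor_lin F (\<Sum>i\<in>I. g i) = (\<Sum>i\<in>I. tensor_lin F (g i))"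
  by (induction I rule: infinite_finite_induct) (simp_all add: tensor_lin_add)

lemma sum_alternating_eq_0:
  fixes B :: "'i \<Rightarrow> 'i \<Rightarrow> 'a::ab_group_add"
  assumes "finite A" "\<And>i. B i i = 0" "\<And>i j. B i j = - B j i"
  shows "(\<Sum>i\<in>A. \<Sum>j\<in>A. B i j) = 0"
  using assms(1)
proof (induction A rule: finite_induct)
  case (insert x A)
  have "(\<Sum>i\<in>A. B i x) = - (\<Sum>i\<in>A. B x i)"
    unfolding sum_negf[symmetric] by (rule sum.cong) (simp_all add: assms(3)[symmetric])
  then show ?case using insert by (simp add: sum.distrib assms(2))
qed simp

text \<open>
  The square of a linear combination of letters contributes the squares of the letters, on which
  \<open>F\<close> vanishes, and each pair of distinct letters together with its transpose, which cancel.
\<close>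

lemma tensor_lin_square:
  assumes F: "alternating_on_words F" and v: "v \<in> tensor_deg1"
  shows "tensor_lin F (Poly_Mapping.single u c * (v * v) * Poly_Mapping.single u' c') = 0"
proof -
  let ?K = "Poly_Mapping.keys v"
  define B where "B = (\<lambda>w w'. tensor_lin F (Poly_Mapping.single u c *
    (Poly_Mapping.single w (Poly_Mapping.lookup v w) *
     Poly_Mapping.single w' (Poly_Mapping.lookup v w')) * Poly_Mapping.single u' c'))"
  define B' where "B' = (\<lambda>w w'. if w \<in> ?K \<and> w' \<in> ?K then B w w' else 0)"
  have B: "B w w' = of_int (c * (Poly_Mapping.lookup v w * Poly_Mapping.lookup v w') * c') *
      F (letters u @ letters w @ letters w' @ letters u')" for w w'
    by (simp add: B_def mult_single tensor_lin_single plus_word_def mult.assoc)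
  have letter: "\<exists>a. letters w = [a]" if "w \<in> ?K" for w
  proof -
    have "length (letters w) = 1" using v that by (auto simp: tensor_deg1_def)
    then show ?thesis by (auto simp: length_Suc_conv)
  qed
  have alt: "F (letters u @ [a, a] @ letters u') = 0"
    "F (letters u @ [a, b] @ letters u') = - F (letters u @ [b, a] @ letters u')" for a b
    using F unfolding alternating_on_words_def by blast+
  have v_sum: "v = (\<Sum>w\<in>?K. Poly_Mapping.single w (Poly_Mapping.lookup v w))"
    by (rule tensor_as_sum)
  have "tensor_lin F (Poly_Mapping.single u c * (v * v) * Poly_Mapping.single u' c')
      = tensor_lin F (Poly_Mapping.single u c *
         ((\<Sum>w\<in>?K. Poly_Mapping.single w (Poly_Mapping.lookup v w)) *
          (\<Sum>w\<in>?K. Poly_Mapping.single w (Poly_Mapping.lookup v w))) * Poly_Mapping.single u' c')"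
    using v_sum by simp
  also have "\<dots> = (\<Sum>w\<in>?K. \<Sum>w'\<in>?K. B w w')"
    unfolding B_def sum_product by (simp add: sum_distrib_left sum_distrib_right tensor_lin_sum)
  also have "\<dots> = (\<Sum>w\<in>?K. \<Sum>w'\<in>?K. B' w w')"
    by (simp add: B'_def)
  also have "\<dots> = 0"
  proof (rule sum_alternating_eq_0)
    fix w w'
    show "B' w w = 0"
      using letter[of w] alt(1) by (auto simp: B'_def B)
    show "B' w w' = - B' w' w"
    proof (cases "w \<in> ?K \<and> w' \<in> ?K")
      case True
      then obtain a b where ab: "letters w = [a]" "letters w' = [b]" using letter by blast
      show ?thesis using True alt(2)[of a b] by (simp add: B'_def B ab mult.commute)
    qed (auto simp: B'_def)
  qed simp
  finally show ?thesis .
qed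

lemma tensor_lin_ideal:
  assumes F: "alternating_on_words F" and "t \<in> ext_ideal"
  shows "tensor_lin F t = 0"
  using assms(2)
proof (induction rule: ext_ideal.induct)
  case (square v x y)
  have "x * (v * v) * y = (\<Sum>w\<in>Poly_Mapping.keys x. Poly_Mapping.single w (Poly_Mapping.lookup x w))
      * (v * v) * (\<Sum>w\<in>Poly_Mapping.keys y. Poly_Mapping.single w (Poly_Mapping.lookup y w))"
    using tensor_as_sum[of x] tensor_as_sum[of y] by simp
  also have "tensor_lin F \<dots> = 0"
    by (simp add: sum_distrib_left sum_distrib_right tensor_lin_sum tensor_lin_square[OF F square])
  finally show ?case .
qed (simp_all add: tensor_lin_add)

text \<open>
  Alternating functions of words induce additive maps on the exterior algebra. Unlike the universal
  property as a ring, this produces determinants.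
\<close>

lemma ext_lin_abs:
  assumes "alternating_on_words F"
  shows "ext_lin F (abs_ext_alg t) = tensor_lin F t"
proof -
  have "ext_eq (rep_ext_alg (abs_ext_alg t)) t"
    by (simp add: Quotient3_ext_alg rep_abs_rsp_left equivp_reflp[OF equivp_ext_eq])
  then have "tensor_lin F (rep_ext_alg (abs_ext_alg t) - t) = 0"
    unfolding ext_eq_def by (rule tensor_lin_ideal[OF assms])
  then show ?thesis by (simp add: ext_lin_def tensor_lin_diff)
qed

lemma ext_lin_hom:
  assumes "alternating_on_words F"
  shows ext_lin_zero: "ext_lin F 0 = 0"
    and ext_lin_add: "ext_lin F (x + y) = ext_lin F x + ext_lin F y"
    and ext_lin_diff: "ext_lin F (x - y) = ext_lin F x - ext_lin F y"
    and ext_lin_word: "ext_lin F (prod_list (map ext_gen xs)) = F xs"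
proof -
  obtain s t where x: "x = abs_ext_alg s" and y: "y = abs_ext_alg t"
    using abs_ext_alg_surj by blast
  show "ext_lin F 0 = 0"
    by (simp add: zero_ext_alg.abs_eq ext_lin_abs[OF assms])
  show "ext_lin F (x + y) = ext_lin F x + ext_lin F y"
    "ext_lin F (x - y) = ext_lin F x - ext_lin F y"
    unfolding x y
    by (simp_all add: plus_ext_alg.abs_eq minus_ext_alg.abs_eq ext_lin_abs[OF assms]
        tensor_lin_add tensor_lin_diff)
  show "ext_lin F (prod_list (map ext_gen xs)) = F xs"
    by (simp add: abs_ext_alg_word[symmetric] ext_lin_abs[OF assms] tensor_lin_single)
qed

lemma ext_lin_sum:
  assumes "alternating_on_words F"
  shows "ext_lin F (\<Sum>i\<in>I. f i) = (\<Sum>i\<in>I. ext_lin F (f i))"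
  by (induction I rule: infinite_finite_induct) (simp_all add: ext_lin_hom[OF assms])

lemma ext_lin_of_int:
  assumes "alternating_on_words F"
  shows "ext_lin F (of_int c * x) = of_int c * ext_lin F x"
  by (induction c rule: int_induct[where k = 0])
     (simp_all add: ext_lin_hom[OF assms] distrib_right left_diff_distrib)

text \<open>
  The matrix has one row for each letter of the word. Words of length different from \<open>k\<close> are sent
  to zero, so that the resulting linear form lives on the component of degree \<open>k\<close>.
\<close>

definition word_det :: "nat \<Rightarrow> ('b \<Rightarrow> nat \<Rightarrow> 'a::comm_ring_1) \<Rightarrow> 'b list \<Rightarrow> 'a" where
  "word_det k g xs = (if length xs = k then det (mat k k (\<lambda>(a, b). g (xs ! a) b)) else 0)"

lemma alternating_word_det: "alternating_on_words (word_det k g)"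
  unfolding alternating_on_words_def
proof (intro conjI allI)
  fix xs ys :: "'a list" and a b
  let ?i = "length xs"
  show "word_det k g (xs @ [a, a] @ ys) = 0"
  proof (cases "length (xs @ [a, a] @ ys) = k")
    case True
    have "det (mat k k (\<lambda>(i, j). g ((xs @ [a, a] @ ys) ! i) j)) = 0"
      by (rule det_identical_rows[of _ k ?i "Suc ?i"])
         (use True in \<open>auto simp: nth_append\<close>)
    then show ?thesis by (simp add: word_det_def)
  qed (simp add: word_det_def)
  show "word_det k g (xs @ [a, b] @ ys) = - word_det k g (xs @ [b, a] @ ys)"
  proof (cases "length (xs @ [a, b] @ ys) = k")
    case True
    have "mat k k (\<lambda>(i, j). g ((xs @ [a, b] @ ys) ! i) j)
        = swaprows ?i (Suc ?i) (mat k k (\<lambda>(i, j). g ((xs @ [b, a] @ ys) ! i) j))"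
      by (rule eq_matI) (use True in \<open>auto simp: nth_append nth_Cons split: nat.splits\<close>)
    then have "det (mat k k (\<lambda>(i, j). g ((xs @ [a, b] @ ys) ! i) j))
        = - det (mat k k (\<lambda>(i, j). g ((xs @ [b, a] @ ys) ! i) j))"
      using True det_swaprows[of ?i k "Suc ?i" "mat k k (\<lambda>(i, j). g ((xs @ [b, a] @ ys) ! i) j)"]
      by simp
    then show ?thesis using True by (simp add: word_det_def)
  qed (simp add: word_det_def)
qed

section \<open>The standard basis of an exterior power\<close>

lemma prod_list_free_part:
  assumes "set vs \<subseteq> free_part B"
  shows "prod_list vs
    \<in> group_closure {prod_list (map ext_gen xs) |xs. length xs = length vs \<and> set xs \<subseteq> B}"
  using assms
proof (induction vs)
  case Nil
  then show ?case by (auto intro!: group_closure.base)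
next
  case (Cons v vs)
  let ?W = "\<lambda>m. {prod_list (map ext_gen xs) |xs. length xs = m \<and> set xs \<subseteq> B}"
  have gen: "ext_gen b * y \<in> group_closure (?W (Suc m))"
    if "b \<in> B" "y \<in> group_closure (?W m)" for b y m
    using that(2)
  proof (induction rule: group_closure.induct)
    case (base y)
    show ?case
    proof (cases "y = 0")
      case False
      then obtain xs where "y = prod_list (map ext_gen xs)" "length xs = m" "set xs \<subseteq> B"
        using base by auto
      then show ?thesis
        using that(1) by (intro group_closure.base insertI2 CollectI exI[of _ "b # xs"]) simp
    qed simp
  next
    case (diff s t)
    then show ?case by (simp add: right_diff_distrib group_closure.diff)
  qed
  have vs: "prod_list vs \<in> group_closure (?W (length vs))" using Cons by simp
  have "v \<in> group_closure (ext_gen ` B)"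
    using Cons.prems by (simp add: free_part_def)
  then have "v * prod_list vs \<in> group_closure (?W (Suc (length vs)))"
  proof (induction rule: group_closure.induct)
    case (base s)
    then show ?case using gen[OF _ vs] by auto
  next
    case (diff s t)
    then show ?case by (simp add: left_diff_distrib group_closure.diff)
  qed
  then show ?case by simp
qed

lemma ext_gen_free_part: "b \<in> B \<Longrightarrow> ext_gen b \<in> free_part B"
  unfolding free_part_def by (auto intro: group_closure.base)

lemma ext_power_words:
  "ext_power B k = group_closure {prod_list (map ext_gen xs) |xs. length xs = k \<and> set xs \<subseteq> B}"
proof
  show "ext_power B k
      \<subseteq> group_closure {prod_list (map ext_gen xs) |xs. length xs = k \<and> set xs \<subseteq> B}"
    unfolding ext_power_def by (rule group_closure_mono) (auto dest: prod_list_free_part)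
  show "group_closure {prod_list (map ext_gen xs) |xs. length xs = k \<and> set xs \<subseteq> B}
      \<subseteq> ext_power B k"
    unfolding ext_power_def
  proof (rule group_closure_mono, clarify)
    fix xs assume "set xs \<subseteq> B" "k = length xs"
    then have "length (map ext_gen xs) = length xs \<and> set (map ext_gen xs) \<subseteq> free_part B"
      by (auto intro: ext_gen_free_part)
    then show "prod_list (map ext_gen xs)
        \<in> group_closure {prod_list vs |vs. length vs = length xs \<and> set vs \<subseteq> free_part B}"
      by (intro group_closure.base) blast
  qed
qed

lemma zero_in_ext_power [simp]: "0 \<in> ext_power B k"
  and ext_power_diff: "x \<in> ext_power B k \<Longrightarrow> y \<in> ext_power B k \<Longrightarrow> x - y \<in> ext_power B k"
  and ext_power_add: "x \<in> ext_power B k \<Longrightarrow> y \<in> ext_power B k \<Longrightarrow> x + y \<in> ext_power B k"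
  and ext_power_uminus: "x \<in> ext_power B k \<Longrightarrow> - x \<in> ext_power B k"
  and ext_power_of_int: "x \<in> ext_power B k \<Longrightarrow> of_int c * x \<in> ext_power B k"
  and ext_power_sum: "(\<And>i. i \<in> I \<Longrightarrow> f i \<in> ext_power B k) \<Longrightarrow> (\<Sum>i\<in>I. f i) \<in> ext_power B k"
  unfolding ext_power_def
  by (auto intro: group_closure.diff group_closure_add group_closure_of_int group_closure_sum)

lemma word_in_ext_power:
  "length xs = k \<Longrightarrow> set xs \<subseteq> B \<Longrightarrow> prod_list (map ext_gen xs) \<in> ext_power B k"
  unfolding ext_power_words by (rule group_closure.base) auto

lemma ext_power_induct [consumes 1, case_names diff word]:
  assumes "x \<in> ext_power B k"
    and "\<And>x y. x \<in> ext_power B k \<Longrightarrow> y \<in> ext_power B k \<Longrightarrow> P x \<Longrightarrow> P y \<Longrightarrow> P (x - y)"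
    and "\<And>xs. length xs = k \<Longrightarrow> set xs \<subseteq> B \<Longrightarrow> P (prod_list (map ext_gen xs))"
    and "P 0"
  shows "P x"
  using assms(1) unfolding ext_power_words
proof (induction rule: group_closure.induct)
  case (base s)
  then show ?case using assms(3,4) by auto
next
  case (diff s t)
  then show ?case using assms(2) unfolding ext_power_words by blast
qed

lemma ext_gen_move:
  "ext_gen a * prod_list (map ext_gen xs)
     \<in> {prod_list (map ext_gen xs) * ext_gen a, - (prod_list (map ext_gen xs) * ext_gen a)}"
proof (induction xs)
  case (Cons b xs)
  have "ext_gen a * (ext_gen b * prod_list (map ext_gen xs))
      = - (ext_gen b * (ext_gen a * prod_list (map ext_gen xs)))"
    by (simp add: mult.assoc[symmetric] ext_gen_anti[of a b])
  then show ?case using Cons.IH by (auto simp: mult.assoc)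
qed simp

lemma word_not_distinct:
  assumes "\<not> distinct xs" shows "prod_list (map ext_gen xs) = 0"
proof -
  obtain as bs cs y where xs: "xs = as @ [y] @ bs @ [y] @ cs"
    using not_distinct_decomp[OF assms] by blast
  let ?P = "\<lambda>xs. prod_list (map ext_gen xs)"
  have "?P xs = ?P as * (ext_gen y * ?P bs) * (ext_gen y * ?P cs)"
    by (simp add: xs mult.assoc)
  also have "\<dots> = 0"
  proof -
    have "(ext_gen y * ?P bs) * ext_gen y = 0"
      using ext_gen_move[of y bs]
    proof (elim insertE emptyE)
      assume "ext_gen y * ?P bs = ?P bs * ext_gen y"
      then have "(ext_gen y * ?P bs) * ext_gen y = ?P bs * (ext_gen y * ext_gen y)"
        by (simp only: mult.assoc)
      then show ?thesis by (simp add: ext_gen_square)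
    next
      assume "ext_gen y * ?P bs = - (?P bs * ext_gen y)"
      then have "(ext_gen y * ?P bs) * ext_gen y = - (?P bs * (ext_gen y * ext_gen y))"
        by (simp only: mult.assoc mult_minus_left)
      then show ?thesis by (simp add: ext_gen_square)
    qed
    then show ?thesis by (metis mult.assoc mult_zero_left mult_zero_right)
  qed
  finally show ?thesis .
qed

text \<open>
  Sorting a word changes it only by a sign, so the increasing words span.
\<close>

lemma word_insort:
  "ext_gen a * prod_list (map ext_gen xs)
     \<in> {prod_list (map ext_gen (insort a xs)), - prod_list (map ext_gen (insort a xs))}"
proof (induction xs)
  case (Cons b xs)
  show ?case
  proof (cases "a \<le> b")
    case False
    have "ext_gen a * (ext_gen b * prod_list (map ext_gen xs))
        = - (ext_gen b * (ext_gen a * prod_list (map ext_gen xs)))"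
      by (simp add: mult.assoc[symmetric] ext_gen_anti[of a b])
    then show ?thesis using Cons.IH False by auto
  qed simp
qed simp

lemma word_sort:
  "prod_list (map ext_gen xs)
     \<in> {prod_list (map ext_gen (sort xs)), - prod_list (map ext_gen (sort xs))}"
proof (induction xs)
  case (Cons a xs)
  then show ?case using word_insort[of a "sort xs"] by auto
qed simp

definition increasing_words :: "'b::linorder set \<Rightarrow> nat \<Rightarrow> 'b list set" where
  "increasing_words B k = {xs. length xs = k \<and> set xs \<subseteq> B \<and> sorted xs \<and> distinct xs}"

lemma ext_power_increasing:
  fixes B :: "'b::linorder set"
  shows "ext_power B k = group_closure ((\<lambda>xs. prod_list (map ext_gen xs)) ` increasing_words B k)"
    (is "_ = group_closure ?E")
proof
  show "ext_power B k \<subseteq> group_closure ?E"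
    unfolding ext_power_words
  proof (rule group_closure_mono, clarify)
    fix xs :: "'b list" assume xs: "set xs \<subseteq> B" "k = length xs"
    show "prod_list (map ext_gen xs)
        \<in> group_closure ((\<lambda>xs. prod_list (map ext_gen xs)) ` increasing_words B (length xs))"
    proof (cases "distinct xs")
      case True
      then have "sort xs \<in> increasing_words B (length xs)"
        using xs by (simp add: increasing_words_def)
      then have "prod_list (map ext_gen (sort xs))
          \<in> group_closure ((\<lambda>xs. prod_list (map ext_gen xs)) ` increasing_words B (length xs))"
        by (intro group_closure.base) blast
      then show ?thesis using word_sort[of xs] by auto
    qed (simp add: word_not_distinct)
  qed
  show "group_closure ?E \<subseteq> ext_power B k"
    unfolding ext_power_words
    by (rule group_closure_mono) (auto simp: increasing_words_def intro!: group_closure.base)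
qed

text \<open>
  The linear form dual to the increasing word \<open>is\<close>: on an increasing word other than \<open>is\<close>, some
  letter does not occur in \<open>is\<close>, and the matrix has a zero row.
\<close>

definition coord :: "'b list \<Rightarrow> 'b ext_alg \<Rightarrow> int" where
  "coord is = ext_lin (word_det (length is) (\<lambda>a j. if a = is ! j then 1 else 0))"

lemma coord_word:
  fixes "is" js :: "'b::linorder list"
  assumes "is \<in> increasing_words B k" "js \<in> increasing_words B k"
  shows "coord is (prod_list (map ext_gen js)) = (if is = js then 1 else 0)"
proof -
  have len: "length is = k" "length js = k" using assms by (auto simp: increasing_words_def)
  let ?A = "mat k k (\<lambda>(i, j). if js ! i = is ! j then 1 else (0::int))"
  have c: "coord is (prod_list (map ext_gen js)) = det ?A"
    by (simp add: coord_def ext_lin_word[OF alternating_word_det] word_det_def len)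
  show ?thesis
  proof (cases "is = js")
    case True
    have "?A = 1\<^sub>m k"
      by (rule eq_matI) (use True assms in \<open>auto simp: increasing_words_def nth_eq_iff_index_eq\<close>)
    then show ?thesis using True c by simp
  next
    case False
    have "set js \<noteq> set is"
      using False assms sorted_distinct_set_unique[of "is" js]
      unfolding increasing_words_def by blast
    moreover have "card (set js) = card (set is)"
      using assms by (simp add: increasing_words_def distinct_card)
    ultimately obtain x where "x \<in> set js" "x \<notin> set is"
      by (metis List.finite_set card_subset_eq subsetI)
    then obtain i where i: "i < k" "js ! i \<notin> set is"
      using len by (auto simp: in_set_conv_nth)
    have zero: "?A $$ (i, p i) = 0" if "p permutes {0..<k}" for p
    proof -
      have "p i < k" using permutes_in_image[OF that, of i] i by simp
      then show ?thesis using i len by auto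
    qed
    have "(\<Prod>i' = 0..<k. ?A $$ (i', p i')) = 0" if "p permutes {0..<k}" for p
      by (rule prod_zero) (use i zero[OF that] in auto)
    then have "det ?A = 0"
      by (subst det_def'[of _ k]) (auto intro!: sum.neutral)
    then show ?thesis using False c by simp
  qed
qed

lemma
  shows coord_sum: "coord is (\<Sum>i\<in>I. f i) = (\<Sum>i\<in>I. coord is (f i))"
    and coord_of_int: "coord is (of_int c * x) = c * coord is x"
  by (simp_all add: coord_def ext_lin_hom[OF alternating_word_det]
      ext_lin_sum[OF alternating_word_det] ext_lin_of_int[OF alternating_word_det])

section \<open>The exterior power as a free module\<close>

lemma ext_power_module_simps [simp]:
  "carrier (ext_power_module n k) = ext_power {1..n} k"
  "add (ext_power_module n k) = (+)"
  "zero (ext_power_module n k) = 0"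
  "module.smult (ext_power_module n k) = (\<lambda>c x. of_int c * x)"
  by (simp_all add: ext_power_module_def)

lemma abelian_group_ext_power_module: "abelian_group (ext_power_module n k)"
proof (rule abelian_groupI)
  fix x assume "x \<in> carrier (ext_power_module n k)"
  then show "\<exists>y\<in>carrier (ext_power_module n k). y \<oplus>\<^bsub>ext_power_module n k\<^esub> x = \<zero>\<^bsub>ext_power_module n k\<^esub>"
    by (intro bexI[of _ "- x"]) (simp_all add: ext_power_uminus)
qed (simp_all add: ext_power_add add.assoc add.commute)

lemma module_ext_power_module: "module \<Z> (ext_power_module n k)"
proof (rule moduleI)
  show "cring \<Z>" by (rule int_is_cring)
qed (simp_all add: abelian_group_ext_power_module ext_power_of_int distrib_left distrib_right
    mult.assoc)

lemma finsum_ext_power_module: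
  assumes "\<And>i. i \<in> I \<Longrightarrow> f i \<in> ext_power {1..n} k"
  shows "(\<Oplus>\<^bsub>ext_power_module n k\<^esub>i\<in>I. f i) = (\<Sum>i\<in>I. f i)"
proof -
  interpret abelian_group "ext_power_module n k" by (rule abelian_group_ext_power_module)
  show ?thesis
    using assms
  proof (induction I rule: infinite_finite_induct)
    case (infinite A)
    then show ?case by (simp add: finsum_infinite)
  next
    case empty
    then show ?case by simp
  next
    case (insert i I)
    then show ?case by (subst finsum_insert) auto
  qed
qed

lemma free_ext_power_module: "free_Z_module (ext_power_module n k)"
proof -
  let ?N = "ext_power_module n k" and ?W = "increasing_words {1..n} k"
  let ?P = "\<lambda>xs :: nat list. prod_list (map ext_gen xs)"
  define ev where "ev = (\<lambda>c :: nat ext_alg \<Rightarrow>\<^sub>0 int.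
    \<Sum>b\<in>Poly_Mapping.keys c. of_int (Poly_Mapping.lookup c b) * b)"
  have B: "?P ` ?W \<subseteq> ext_power {1..n} k"
    by (auto simp: increasing_words_def intro: word_in_ext_power)
  have sum: "(\<Oplus>\<^bsub>?N\<^esub>b\<in>Poly_Mapping.keys c. Poly_Mapping.lookup c b \<odot>\<^bsub>?N\<^esub> b) = ev c"
    if "Poly_Mapping.keys c \<subseteq> ?P ` ?W" for c
    unfolding ev_def ext_power_module_simps
    by (rule finsum_ext_power_module, rule ext_power_of_int) (use B that in blast)
  have ev_superset: "ev c = (\<Sum>b\<in>S. of_int (Poly_Mapping.lookup c b) * b)"
    if "finite S" "Poly_Mapping.keys c \<subseteq> S" for c S
    unfolding ev_def
    by (rule sum.mono_neutral_left) (use that in \<open>auto simp: in_keys_iff\<close>)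
  have ev_diff: "ev (c - d) = ev c - ev d" for c d
  proof -
    let ?S = "Poly_Mapping.keys c \<union> Poly_Mapping.keys d"
    have "Poly_Mapping.keys (c - d) \<subseteq> ?S" by (rule keys_diff)
    then show ?thesis
      by (simp add: ev_superset[of ?S] lookup_minus left_diff_distrib sum_subtractf)
  qed
  have exist: "\<exists>c. Poly_Mapping.keys c \<subseteq> ?P ` ?W \<and> x = ev c" if "x \<in> ext_power {1..n} k" for x
    using that unfolding ext_power_increasing
  proof (induction rule: group_closure.induct)
    case (base s)
    show ?case
    proof (cases "s = 0")
      case True
      then show ?thesis by (intro exI[of _ 0]) (simp add: ev_def)
    next
      case False
      then show ?thesis using base
        by (intro exI[of _ "Poly_Mapping.single s 1"]) (simp add: ev_def)
    qed
  next
    case (diff s t)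
    then obtain c d where "Poly_Mapping.keys c \<subseteq> ?P ` ?W" "s = ev c"
      "Poly_Mapping.keys d \<subseteq> ?P ` ?W" "t = ev d" by blast
    moreover have "Poly_Mapping.keys (c - d) \<subseteq> Poly_Mapping.keys c \<union> Poly_Mapping.keys d"
      by (rule keys_diff)
    ultimately show ?case by (intro exI[of _ "c - d"]) (auto simp: ev_diff)
  qed
  have coord_ev: "coord is (ev c) = Poly_Mapping.lookup c (?P is)"
    if "is \<in> ?W" "Poly_Mapping.keys c \<subseteq> ?P ` ?W" for "is" c
  proof -
    have "coord is b = (if b = ?P is then 1 else 0)" if "b \<in> Poly_Mapping.keys c" for b
    proof -
      obtain js where js: "js \<in> ?W" "b = ?P js"
        using \<open>b \<in> Poly_Mapping.keys c\<close> \<open>Poly_Mapping.keys c \<subseteq> ?P ` ?W\<close> by blast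
      have "is = js" if "?P is = ?P js"
        using coord_word[OF \<open>is \<in> ?W\<close> js(1)] coord_word[OF \<open>is \<in> ?W\<close> \<open>is \<in> ?W\<close>] that
        by (auto split: if_splits)
      then show ?thesis using coord_word[OF \<open>is \<in> ?W\<close> js(1)] js(2) by auto
    qed
    then have "coord is (ev c) = (\<Sum>b\<in>Poly_Mapping.keys c.
        if b = ?P is then Poly_Mapping.lookup c b else 0)"
      unfolding ev_def coord_sum coord_of_int by (intro sum.cong) auto
    then show ?thesis by (simp add: in_keys_iff)
  qed
  have unique: "c = d" if "Poly_Mapping.keys c \<subseteq> ?P ` ?W" "Poly_Mapping.keys d \<subseteq> ?P ` ?W"
    "ev c = ev d" for c d
  proof (rule poly_mapping_eqI)
    fix b
    show "Poly_Mapping.lookup c b = Poly_Mapping.lookup d b"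
    proof (cases "b \<in> ?P ` ?W")
      case True
      then obtain "is" where "is": "is \<in> ?W" "b = ?P is" by blast
      have "coord is (ev c) = coord is (ev d)" using that(3) by simp
      then show ?thesis unfolding coord_ev[OF "is"(1) that(1)] coord_ev[OF "is"(1) that(2)] "is"(2) .
    next
      case False
      then have "b \<notin> Poly_Mapping.keys c" "b \<notin> Poly_Mapping.keys d" using that by blast+
      then show ?thesis by (simp add: in_keys_iff)
    qed
  qed
  have "is_Z_basis ?N (?P ` ?W)"
    unfolding is_Z_basis_def
  proof (intro conjI ballI)
    show "?P ` ?W \<subseteq> carrier ?N" using B by simp
    fix x assume "x \<in> carrier ?N"
    then obtain c where c: "Poly_Mapping.keys c \<subseteq> ?P ` ?W" "x = ev c" using exist by auto
    show "\<exists>!c. Poly_Mapping.keys c \<subseteq> ?P ` ?W \<and>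
      x = (\<Oplus>\<^bsub>?N\<^esub>b\<in>Poly_Mapping.keys c. Poly_Mapping.lookup c b \<odot>\<^bsub>?N\<^esub> b)"
    proof (rule ex1I[of _ c])
      show "Poly_Mapping.keys c \<subseteq> ?P ` ?W \<and>
        x = (\<Oplus>\<^bsub>?N\<^esub>b\<in>Poly_Mapping.keys c. Poly_Mapping.lookup c b \<odot>\<^bsub>?N\<^esub> b)"
        using c sum by simp
    next
      fix d assume "Poly_Mapping.keys d \<subseteq> ?P ` ?W \<and>
        x = (\<Oplus>\<^bsub>?N\<^esub>b\<in>Poly_Mapping.keys d. Poly_Mapping.lookup d b \<odot>\<^bsub>?N\<^esub> b)"
      then have "Poly_Mapping.keys d \<subseteq> ?P ` ?W" "ev d = ev c" using c sum by simp_all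
      then show "d = c" using c(1) by (intro unique)
    qed
  qed
  then show ?thesis unfolding free_Z_module_def using module_ext_power_module by blast
qed

section \<open>Polynomials in commuting operators\<close>

lemma carrier_int_mpoly_ring:
  "p \<in> carrier (int_mpoly_ring V) \<longleftrightarrow> (\<forall>m\<in>Poly_Mapping.keys p. Poly_Mapping.keys m \<subseteq> V)"
  by (simp add: int_mpoly_ring_def)

lemma int_mpoly_ring_simps [simp]:
  "mult (int_mpoly_ring V) = (*)" "one (int_mpoly_ring V) = 1"
  "zero (int_mpoly_ring V) = 0" "add (int_mpoly_ring V) = (+)"
  by (simp_all add: int_mpoly_ring_def)

lemma of_int_eq_single: "(of_int c :: int_mpoly) = Poly_Mapping.single 0 c"
  by (induction c rule: int_induct[where k = 0]) (simp_all add: single_add single_diff)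

lemma
  shows int_mpoly_zero [simp]: "0 \<in> carrier (int_mpoly_ring V)"
    and int_mpoly_one [simp]: "1 \<in> carrier (int_mpoly_ring V)"
    and int_mpoly_of_int [simp]: "of_int c \<in> carrier (int_mpoly_ring V)"
    and int_mpoly_mvar: "i \<in> V \<Longrightarrow> mvar i \<in> carrier (int_mpoly_ring V)"
    and int_mpoly_add: "p \<in> carrier (int_mpoly_ring V) \<Longrightarrow> q \<in> carrier (int_mpoly_ring V) \<Longrightarrow>
      p + q \<in> carrier (int_mpoly_ring V)"
    and int_mpoly_uminus: "p \<in> carrier (int_mpoly_ring V) \<Longrightarrow> - p \<in> carrier (int_mpoly_ring V)"
  using Poly_Mapping.keys_add[of p q]
  by (auto simp: carrier_int_mpoly_ring of_int_eq_single mvar_def)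

lemma int_mpoly_diff:
  "p \<in> carrier (int_mpoly_ring V) \<Longrightarrow> q \<in> carrier (int_mpoly_ring V) \<Longrightarrow>
    p - q \<in> carrier (int_mpoly_ring V)"
  using int_mpoly_add[of p V "- q"] int_mpoly_uminus[of q V] by simp

lemma int_mpoly_mult:
  assumes "p \<in> carrier (int_mpoly_ring V)" "q \<in> carrier (int_mpoly_ring V)"
  shows "p * q \<in> carrier (int_mpoly_ring V)"
  unfolding carrier_int_mpoly_ring
proof
  fix m assume "m \<in> Poly_Mapping.keys (p * q)"
  then obtain a b where "m = a + b" "a \<in> Poly_Mapping.keys p" "b \<in> Poly_Mapping.keys q"
    using keys_mult[of p q] by blast
  then show "Poly_Mapping.keys m \<subseteq> V"
    using assms Poly_Mapping.keys_add[of a b] unfolding carrier_int_mpoly_ring by blast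
qed

lemma int_mpoly_sum:
  "(\<And>i. i \<in> I \<Longrightarrow> f i \<in> carrier (int_mpoly_ring V)) \<Longrightarrow> (\<Sum>i\<in>I. f i) \<in> carrier (int_mpoly_ring V)"
  by (induction I rule: infinite_finite_induct) (auto intro: int_mpoly_add)

lemma int_mpoly_prod:
  "(\<And>i. i \<in> I \<Longrightarrow> f i \<in> carrier (int_mpoly_ring V)) \<Longrightarrow> (\<Prod>i\<in>I. f i) \<in> carrier (int_mpoly_ring V)"
  by (induction I rule: infinite_finite_induct) (auto intro: int_mpoly_mult)

lemma cring_int_mpoly_ring: "cring (int_mpoly_ring V)"
proof (rule cringI)
  show "abelian_group (int_mpoly_ring V)"
  proof (rule abelian_groupI)
    fix x assume "x \<in> carrier (int_mpoly_ring V)"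
    then show "\<exists>y\<in>carrier (int_mpoly_ring V). y \<oplus>\<^bsub>int_mpoly_ring V\<^esub> x = \<zero>\<^bsub>int_mpoly_ring V\<^esub>"
      by (intro bexI[of _ "- x"]) (simp_all add: int_mpoly_uminus)
  qed (simp_all add: int_mpoly_add add.assoc add.commute)
  show "comm_monoid (int_mpoly_ring V)"
    by (rule comm_monoidI) (simp_all add: int_mpoly_mult mult.assoc mult.commute)
qed (simp add: distrib_right)

text \<open>
  Multiplication by one variable at a time avoids all reasoning about exponent vectors in the
  sequel.
\<close>

lemma int_mpoly_induct [consumes 1, case_names const add mvar]:
  assumes P: "P \<in> carrier (int_mpoly_ring V)"
    and const: "\<And>c. Q (of_int c)"
    and add: "\<And>p q. Q p \<Longrightarrow> Q q \<Longrightarrow> Q (p + q)"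
    and mvar: "\<And>i p. i \<in> V \<Longrightarrow> Q p \<Longrightarrow> Q (mvar i * p)"
  shows "Q P"
proof -
  have power: "Q (Poly_Mapping.single (Poly_Mapping.single i e + m) c)"
    if "i \<in> V" "Q (Poly_Mapping.single m c)" for i e m c
  proof (induction e)
    case 0
    then show ?case using that by simp
  next
    case (Suc e)
    have "Poly_Mapping.single i (Suc e) = Poly_Mapping.single i 1 + Poly_Mapping.single i e"
      by (simp add: single_add[symmetric])
    then have "Poly_Mapping.single (Poly_Mapping.single i (Suc e) + m) c
        = mvar i * Poly_Mapping.single (Poly_Mapping.single i e + m) c"
      by (simp add: mvar_def mult_single add.assoc)
    then show ?case using mvar[OF that(1) Suc.IH] by simp
  qed
  have prod: "Q (Poly_Mapping.single (\<Sum>i\<in>A. Poly_Mapping.single i (f i)) c)"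
    if "finite A" "A \<subseteq> V" for A f c
    using that
  proof (induction A rule: finite_induct)
    case empty
    then show ?case using const[of c] by (simp add: of_int_eq_single)
  next
    case (insert i A)
    then show ?case using power by simp
  qed
  have monomial: "Q (Poly_Mapping.single m c)" if "Poly_Mapping.keys m \<subseteq> V" for m c
  proof -
    have "m = (\<Sum>i\<in>Poly_Mapping.keys m. Poly_Mapping.single i (Poly_Mapping.lookup m i))"
      by (rule poly_mapping_eqI) (auto simp: lookup_sum lookup_single when_def in_keys_iff)
    then show ?thesis using prod[OF _ that, of "Poly_Mapping.lookup m" c] by simp
  qed
  have "Q (\<Sum>m\<in>A. Poly_Mapping.single m (Poly_Mapping.lookup P m))"
    if "finite A" "A \<subseteq> Poly_Mapping.keys P" for A
    using that
  proof (induction A rule: finite_induct)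
    case empty
    then show ?case using const[of 0] by simp
  next
    case (insert m A)
    then show ?case using add monomial P by (simp add: carrier_int_mpoly_ring)
  qed
  moreover have "P = (\<Sum>m\<in>Poly_Mapping.keys P. Poly_Mapping.single m (Poly_Mapping.lookup P m))"
    by (rule poly_mapping_eqI) (auto simp: lookup_sum lookup_single when_def in_keys_iff)
  ultimately show ?thesis by (metis finite_keys order_refl)
qed

lemma mem_int_mpoly_ring_UNIV: "P \<in> carrier (int_mpoly_ring UNIV)"
  by (simp add: carrier_int_mpoly_ring)

locale commuting_operators =
  fixes D :: "nat \<Rightarrow> 'a::ring_1 \<Rightarrow> 'a"
  assumes D_add: "D i (x + y) = D i x + D i y"
    and D_commute: "D i (D j x) = D j (D i x)"
begin

lemma D_zero [simp]: "D i 0 = 0"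
  using D_add[of i 0 0] by simp

lemma D_diff: "D i (x - y) = D i x - D i y"
  by (metis D_add add_diff_cancel_right' diff_add_cancel)

lemma D_sum: "D i (\<Sum>j\<in>I. f j) = (\<Sum>j\<in>I. D i (f j))"
  by (induction I rule: infinite_finite_induct) (simp_all add: D_add)

lemma D_of_int: "D i (of_int c * x) = of_int c * D i x"
  by (induction c rule: int_induct[where k = 0])
     (simp_all add: distrib_right left_diff_distrib D_add D_diff)

lemma funpow_D_commute: "(D j ^^ e) (D i x) = D i ((D j ^^ e) x)"
  by (induction e) (simp_all add: D_commute[of j i])

lemma fold_D_commute: "fold (\<lambda>j. D j ^^ e j) js (D i x) = D i (fold (\<lambda>j. D j ^^ e j) js x)"
  by (induction js arbitrary: x) (simp_all add: funpow_D_commute)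

text \<open>
  Raising one exponent amounts to one more application of the corresponding operator, which may
  be moved to the front.
\<close>

lemma fold_D_Suc:
  assumes "distinct js" "i \<in> set js" "e' i = Suc (e i)" "\<And>j. j \<noteq> i \<Longrightarrow> e' j = e j"
  shows "fold (\<lambda>j. D j ^^ e' j) js x = D i (fold (\<lambda>j. D j ^^ e j) js x)"
  using assms(1,2)
proof (induction js arbitrary: x)
  case (Cons a js)
  show ?case
  proof (cases "a = i")
    case True
    have "fold (\<lambda>j. D j ^^ e' j) js y = fold (\<lambda>j. D j ^^ e j) js y" for y
    proof (intro fold_cong refl)
      fix b assume "b \<in> set js"
      then have "b \<noteq> i" using Cons.prems True by auto
      then show "D b ^^ e' b = D b ^^ e b" by (simp add: assms(4))
    qed
    then show ?thesis
      using True assms(3) by (simp add: fold_D_commute)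
  next
    case False
    then show ?thesis using Cons assms(4) by simp
  qed
qed simp

lemma monom_apply_superset:
  assumes "finite S" "Poly_Mapping.keys m \<subseteq> S"
  shows "monom_apply D m x = fold (\<lambda>j. D j ^^ Poly_Mapping.lookup m j) (sorted_list_of_set S) x"
proof -
  let ?f = "\<lambda>j. D j ^^ Poly_Mapping.lookup m j"
  have skip: "fold ?f (filter (\<lambda>j. j \<in> Poly_Mapping.keys m) js) y = fold ?f js y" for js y
    by (induction js arbitrary: y) (auto simp: in_keys_iff)
  have "sorted_list_of_set (Poly_Mapping.keys m)
      = filter (\<lambda>j. j \<in> Poly_Mapping.keys m) (sorted_list_of_set S)"
    by (rule sorted_distinct_set_unique) (use assms in \<open>auto simp: sorted_wrt_filter\<close>)
  then show ?thesis unfolding monom_apply_def by (simp add: skip)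
qed

lemma monom_apply_single_add:
  "monom_apply D (Poly_Mapping.single i 1 + m) x = D i (monom_apply D m x)"
proof -
  obtain S where S: "finite S" "i \<in> S" "Poly_Mapping.keys m \<subseteq> S"
    by (metis finite_insert finite_keys insertI1 subset_insertI)
  have "Poly_Mapping.keys (Poly_Mapping.single i 1 + m) \<subseteq> S"
    using S Poly_Mapping.keys_add[of "Poly_Mapping.single i 1" m] by auto
  then have "monom_apply D (Poly_Mapping.single i 1 + m) x
      = fold (\<lambda>j. D j ^^ Poly_Mapping.lookup (Poly_Mapping.single i 1 + m) j)
          (sorted_list_of_set S) x"
    by (rule monom_apply_superset[OF S(1)])
  also have "\<dots> = D i (fold (\<lambda>j. D j ^^ Poly_Mapping.lookup m j) (sorted_list_of_set S) x)"
    by (rule fold_D_Suc) (use S in \<open>auto simp: lookup_add lookup_single\<close>)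
  also have "\<dots> = D i (monom_apply D m x)"
    using S by (simp add: monom_apply_superset[of S])
  finally show ?thesis .
qed

text \<open>
  The element \<open>P(D) x\<close>, with the sum taken in the ambient ring rather than in a module.
\<close>

definition eval_ops :: "int_mpoly \<Rightarrow> 'a \<Rightarrow> 'a" where
  "eval_ops P x = (\<Sum>m\<in>Poly_Mapping.keys P. of_int (Poly_Mapping.lookup P m) * monom_apply D m x)"

lemma eval_ops_superset:
  assumes "finite S" "Poly_Mapping.keys P \<subseteq> S"
  shows "eval_ops P x = (\<Sum>m\<in>S. of_int (Poly_Mapping.lookup P m) * monom_apply D m x)"
  unfolding eval_ops_def
  by (rule sum.mono_neutral_left) (use assms in \<open>auto simp: in_keys_iff\<close>)

lemma eval_ops_zero [simp]: "eval_ops 0 x = 0"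
  by (simp add: eval_ops_def)

lemma eval_ops_add: "eval_ops (P + Q) x = eval_ops P x + eval_ops Q x"
proof -
  let ?S = "Poly_Mapping.keys P \<union> Poly_Mapping.keys Q"
  have "Poly_Mapping.keys (P + Q) \<subseteq> ?S" by (rule Poly_Mapping.keys_add)
  then show ?thesis
    by (simp add: eval_ops_superset[of ?S] lookup_add distrib_right sum.distrib)
qed

lemma eval_ops_diff: "eval_ops (P - Q) x = eval_ops P x - eval_ops Q x"
  by (metis eval_ops_add add_diff_cancel_right' diff_add_cancel)

lemma eval_ops_uminus: "eval_ops (- P) x = - eval_ops P x"
  using eval_ops_diff[of 0 P x] by simp

lemma eval_ops_sum: "eval_ops (\<Sum>i\<in>I. f i) x = (\<Sum>i\<in>I. eval_ops (f i) x)"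
  by (induction I rule: infinite_finite_induct) (simp_all add: eval_ops_add)

lemma eval_ops_single: "eval_ops (Poly_Mapping.single m c) x = of_int c * monom_apply D m x"
  by (cases "c = 0") (simp_all add: eval_ops_def)

lemma eval_ops_of_int [simp]: "eval_ops (of_int c) x = of_int c * x"
  by (simp add: of_int_eq_single eval_ops_single monom_apply_def)

lemma eval_ops_one [simp]: "eval_ops 1 x = x"
  using eval_ops_of_int[of 1 x] by simp

lemma eval_ops_of_int_mult: "eval_ops (of_int c * P) x = of_int c * eval_ops P x"
  by (induction c rule: int_induct[where k = 0])
     (simp_all add: distrib_right left_diff_distrib eval_ops_add eval_ops_diff)

lemma eval_ops_mvar_mult: "eval_ops (mvar i * P) x = D i (eval_ops P x)"
proof -
  let ?K = "Poly_Mapping.keys P" and ?c = "Poly_Mapping.lookup P"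
  have P: "P = (\<Sum>m\<in>?K. Poly_Mapping.single m (?c m))"
    by (rule poly_mapping_eqI) (auto simp: lookup_sum lookup_single when_def in_keys_iff)
  have "eval_ops (mvar i * P) x = eval_ops (mvar i * (\<Sum>m\<in>?K. Poly_Mapping.single m (?c m))) x"
    using P by simp
  also have "\<dots> = (\<Sum>m\<in>?K. of_int (?c m) * D i (monom_apply D m x))"
    by (simp add: sum_distrib_left eval_ops_sum mvar_def mult_single eval_ops_single
        monom_apply_single_add[simplified])
  also have "\<dots> = D i (eval_ops P x)"
    by (simp add: eval_ops_def D_sum D_of_int)
  finally show ?thesis .
qed

lemma eval_ops_mvar [simp]: "eval_ops (mvar i) x = D i x"
  using eval_ops_mvar_mult[of i 1 x] by simp

lemma eval_ops_mult: "eval_ops (P * Q) x = eval_ops P (eval_ops Q x)"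
  using mem_int_mpoly_ring_UNIV[of P]
  by (induction rule: int_mpoly_induct)
     (simp_all add: eval_ops_of_int_mult distrib_right eval_ops_add eval_ops_mvar_mult mult.assoc)

lemma eval_ops_commute: "eval_ops P (eval_ops Q x) = eval_ops Q (eval_ops P x)"
  by (simp add: eval_ops_mult[symmetric] mult.commute)

lemma eval_ops_add_right: "eval_ops P (x + y) = eval_ops P x + eval_ops P y"
  using mem_int_mpoly_ring_UNIV[of P]
  by (induction rule: int_mpoly_induct)
     (simp_all add: distrib_left eval_ops_add eval_ops_mvar_mult D_add)

lemma eval_ops_zero_right [simp]: "eval_ops P 0 = 0"
  using eval_ops_add_right[of P 0 0] by simp

lemma eval_ops_diff_right: "eval_ops P (x - y) = eval_ops P x - eval_ops P y"
  by (metis eval_ops_add_right add_diff_cancel_right' diff_add_cancel)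

lemma eval_ops_closed:
  assumes "P \<in> carrier (int_mpoly_ring V)" "x \<in> S"
    and diff: "\<And>y z. y \<in> S \<Longrightarrow> z \<in> S \<Longrightarrow> y - z \<in> S"
    and D: "\<And>i y. i \<in> V \<Longrightarrow> y \<in> S \<Longrightarrow> D i y \<in> S"
  shows "eval_ops P x \<in> S"
proof -
  have zero: "0 \<in> S" using diff[OF assms(2) assms(2)] by simp
  have add: "y + z \<in> S" if "y \<in> S" "z \<in> S" for y z
    using diff[OF that(1) diff[OF zero that(2)]] by simp
  have const: "of_int c * x \<in> S" for c
    by (induction c rule: int_induct[where k = 0])
       (simp_all add: zero distrib_right left_diff_distrib add diff assms(2))
  show ?thesis
    using assms(1)
    by (induction rule: int_mpoly_induct) (simp_all add: const eval_ops_add eval_ops_mvar_mult add D)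
qed

end

section \<open>The operators on the exterior algebra\<close>

text \<open>The image of \<open>\<epsilon>\<^sup>i\<close> in \<open>M\<^sub>n\<close>; the index \<open>0\<close>, which names no basis element, gives zero.\<close>

definition egen :: "nat \<Rightarrow> nat \<Rightarrow> nat ext_alg" where
  "egen n i = (if 1 \<le> i \<and> i \<le> n then ext_gen i else 0)"

lemma D_basis_nth: "fps_nth (D_basis n i) j = (if 1 \<le> i then egen n (i + j) else 0)"
  by (simp add: D_basis_def egen_def)

lemma D_t_zero: "D_t n 0 = 0"
  unfolding D_t_def by (rule ext_lift_zero[OF alternating_D_basis])

lemma D_t_egen: "D_t n (egen n i) = D_basis n i"
  by (auto simp: egen_def D_t_gen D_t_zero fps_eq_iff D_basis_def)

lemma D_op_mult: "D_op n h (x * y) = (\<Sum>i = 0..h. D_op n i x * D_op n (h - i) y)"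
  by (simp add: D_op_def D_t_mult fps_mult_nth)

lemma D_op_one: "D_op n h 1 = (if h = 0 then 1 else 0)"
  by (simp add: D_op_def D_t_one)

lemma D_op_gen: "D_op n h (ext_gen i) = (if 1 \<le> i then egen n (i + h) else 0)"
  by (simp add: D_op_def D_t_gen D_basis_nth)

lemma D_op_egen: "D_op n h (egen n i) = (if 1 \<le> i then egen n (i + h) else 0)"
  by (simp add: D_op_def D_t_egen D_basis_nth)

lemma D_op_add: "D_op n h (x + y) = D_op n h x + D_op n h y"
  by (simp add: D_op_def D_t_add)

lemma D_op_sum: "D_op n h (\<Sum>j\<in>I. f j) = (\<Sum>j\<in>I. D_op n h (f j))"
  by (induction I rule: infinite_finite_induct) (simp_all add: D_op_add, simp_all add: D_op_def D_t_zero)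

text \<open>
  On a generator both compositions shift the index by \<open>i + j\<close>; for a product, the Leibniz rule
  \<open>D_op_mult\<close> applied twice is symmetric in the two operators.
\<close>

lemma D_op_commute: "D_op n i (D_op n j x) = D_op n j (D_op n i x)"
proof (induction x arbitrary: i j rule: ext_alg_induct)
  case (diff x y)
  have D_diff: "D_op n h (x - y) = D_op n h x - D_op n h y" for h x y
    by (metis D_op_add add_diff_cancel_right' diff_add_cancel)
  show ?case by (simp only: D_diff diff)
next
  case (word xs)
  show ?case
  proof (induction xs arbitrary: i j)
    case Nil
    then show ?case by (simp add: D_op_one D_op_def D_t_zero D_t_one)
  next
    case (Cons a xs)
    let ?y = "prod_list (map ext_gen xs)"
    have gen: "D_op n i (D_op n j (ext_gen a)) = D_op n j (D_op n i (ext_gen a))" for i j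
      by (simp add: D_op_gen D_op_egen add_ac) (simp add: D_op_def D_t_zero)
    have "D_op n i (D_op n j (ext_gen a * ?y))
        = (\<Sum>p = 0..j. \<Sum>q = 0..i. D_op n q (D_op n p (ext_gen a)) *
            D_op n (i - q) (D_op n (j - p) ?y))"
      by (simp add: D_op_mult D_op_sum)
    also have "\<dots> = (\<Sum>q = 0..i. \<Sum>p = 0..j. D_op n p (D_op n q (ext_gen a)) *
            D_op n (j - p) (D_op n (i - q) ?y))"
      by (subst sum.swap) (simp add: gen Cons.IH)
    also have "\<dots> = D_op n j (D_op n i (ext_gen a * ?y))"
      by (simp add: D_op_mult D_op_sum)
    finally show ?case by simp
  qed
qed

global_interpretation D_op: commuting_operators "D_op n" for n
  defines op_poly = D_op.eval_ops
  by standard (rule D_op_add D_op_commute)+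

text \<open>A product of shifted generators is indexed by the list of the shifts.\<close>

lemma sum_natpermute_Suc:
  "(\<Sum>v\<in>natpermute h (Suc m). f v) = (\<Sum>i = 0..h. \<Sum>v\<in>natpermute (h - i) m. f (i # v))"
proof -
  have "(\<Sum>i = 0..h. \<Sum>v\<in>natpermute (h - i) m. f (i # v))
      = (\<Sum>(i, v)\<in>(SIGMA i:{0..h}. natpermute (h - i) m). f (i # v))"
    by (rule sum.Sigma) (auto intro: natpermute_finite)
  also have "\<dots> = (\<Sum>v\<in>natpermute h (Suc m). f v)"
    by (rule sum.reindex_bij_witness[of _ "\<lambda>v. (hd v, tl v)" "\<lambda>(i, v). i # v"])
       (auto simp: natpermute_def length_Suc_conv)
  finally show ?thesis by simp
qed

lemma D_op_word:
  assumes "0 \<notin> set xs"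
  shows "D_op n h (prod_list (map ext_gen xs))
    = (\<Sum>v\<in>natpermute h (length xs). prod_list (map (egen n) (map2 (+) xs v)))"
  using assms
proof (induction xs arbitrary: h)
  case Nil
  then show ?case by (simp add: D_op_one natpermute_0)
next
  case (Cons a xs)
  then show ?case
    by (simp add: D_op_mult D_op_gen sum_natpermute_Suc sum_distrib_left)
qed

lemma egen_word:
  "prod_list (map (egen n) xs) = (if set xs \<subseteq> {1..n} then prod_list (map ext_gen xs) else 0)"
proof (cases "set xs \<subseteq> {1..n}")
  case True
  then have "map (egen n) xs = map ext_gen xs" by (intro map_cong) (auto simp: egen_def)
  then show ?thesis using True by (simp only: if_True)
next
  case False
  then obtain i where "i \<in> set xs" "i \<notin> {1..n}" by blast
  then obtain ys zs where "xs = ys @ i # zs" "egen n i = 0"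
    by (metis atLeastAtMost_iff egen_def split_list)
  then have "prod_list (map (egen n) xs) = 0" by simp
  then show ?thesis by (simp only: if_not_P[OF False])
qed

lemma egen_word_in_ext_power:
  "length xs = k \<Longrightarrow> prod_list (map (egen n) xs) \<in> ext_power {1..n} k"
  by (auto simp: egen_word intro: word_in_ext_power simp del: atLeastAtMost_iff)

lemma D_op_in_ext_power:
  assumes "x \<in> ext_power {1..n} k" shows "D_op n h x \<in> ext_power {1..n} k"
  using assms
proof (induction rule: ext_power_induct)
  case (diff x y)
  then show ?case by (simp add: D_op.D_diff ext_power_diff)
next
  case (word xs)
  then have "0 \<notin> set xs" by auto
  then show ?case
    unfolding D_op_word[OF \<open>0 \<notin> set xs\<close>]
    by (intro ext_power_sum egen_word_in_ext_power) (use word in \<open>simp add: natpermute_def\<close>)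
qed simp

lemma D_op_0:
  assumes "x \<in> ext_power {1..n} k" shows "D_op n 0 x = x"
  using assms
proof (induction rule: ext_power_induct)
  case (diff x y)
  then show ?case by (simp add: D_op.D_diff)
next
  case (word xs)
  from word(2) show ?case
    by (induction xs) (auto simp: D_op_one D_op_mult D_op_gen egen_def)
qed simp

lemma op_poly_in_ext_power:
  "x \<in> ext_power {1..n} k \<Longrightarrow> op_poly n P x \<in> ext_power {1..n} k"
  by (rule D_op.eval_ops_closed[OF mem_int_mpoly_ring_UNIV]) (blast intro: ext_power_diff D_op_in_ext_power)+

lemma poly_apply_ext_power_module:
  assumes "x \<in> ext_power {1..n} k"
  shows "poly_apply (ext_power_module n k) (D_op n) P x = op_poly n P x"
proof -
  have "monom_apply (D_op n) m x \<in> ext_power {1..n} k" for m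
    using op_poly_in_ext_power[OF assms, of "Poly_Mapping.single m 1"] by (simp add: D_op.eval_ops_single)
  then show ?thesis
    unfolding poly_apply_def D_op.eval_ops_def ext_power_module_simps
    by (intro finsum_ext_power_module ext_power_of_int)
qed

section \<open>The fundamental element generates\<close>

text \<open>
  Integration by parts: \<open>D\<^sub>t \<epsilon>\<^sup>i = \<epsilon>\<^sup>i + t D\<^sub>t \<epsilon>\<^sup>i\<^sup>+\<^sup>1\<close>, so multiplying by the last factor commutes with
  \<open>D\<^sub>t\<close> up to a shift of that factor.
\<close>

lemma D_basis_shift:
  assumes "1 \<le> i"
  shows "D_basis n i = fps_const (egen n i) + fps_X * D_basis n (Suc i)"
  by (rule fps_ext) (use assms in \<open>simp add: D_basis_nth\<close>)

lemma D_op_mult_egen: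
  assumes "1 \<le> i"
  shows "D_op n h (x * egen n i)
    = D_op n h x * egen n i + (if h = 0 then 0 else D_op n (h - 1) (x * egen n (Suc i)))"
proof -
  have "D_t n (x * egen n i) = D_t n x * (fps_const (egen n i) + fps_X * D_basis n (Suc i))"
    by (simp add: D_t_mult D_t_egen D_basis_shift[OF assms])
  also have "\<dots> = D_t n x * fps_const (egen n i) + fps_X * D_t n (x * egen n (Suc i))"
    by (simp add: D_t_mult D_t_egen distrib_left) (metis mult.assoc fps_mult_fps_X_commute)
  finally show ?thesis unfolding D_op_def by simp
qed

lemma mult_egen_in_ext_power:
  assumes "x \<in> ext_power {1..n} k"
  shows "x * egen n i \<in> ext_power {1..n} (Suc k)"
  using assms
proof (induction rule: ext_power_induct)
  case (diff x y)
  then show ?case by (simp add: left_diff_distrib ext_power_diff)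
next
  case (word xs)
  then have "prod_list (map ext_gen xs) * egen n i = prod_list (map (egen n) (xs @ [i]))"
    by (simp add: egen_word)
  then show ?case using word by (simp only:) (intro egen_word_in_ext_power, simp)
qed simp

lemma ext_power_Suc_induct [consumes 1, case_names diff mult_egen]:
  assumes "z \<in> ext_power {1..n} (Suc k)"
    and diff: "\<And>x y. P x \<Longrightarrow> P y \<Longrightarrow> P (x - y)"
    and mult: "\<And>x i. x \<in> ext_power {1..n} k \<Longrightarrow> 1 \<le> i \<Longrightarrow> P (x * egen n i)"
  shows "P z"
  using assms(1)
proof (induction rule: ext_power_induct)
  case (word xs)
  then obtain ys i where xs: "xs = ys @ [i]" by (metis length_Suc_conv_rev)
  then have "P (prod_list (map ext_gen ys) * egen n i)"
    using word by (intro mult word_in_ext_power) auto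
  then show ?case using word xs by (simp add: egen_def)
qed (use mult[of 0 1] in \<open>simp_all add: diff\<close>)

definition fundamental :: "nat \<Rightarrow> nat \<Rightarrow> nat ext_alg" where
  "fundamental n k = prod_list (map (egen n) [1..<Suc k])"

lemma fundamental_Suc: "fundamental n (Suc k) = fundamental n k * egen n (Suc k)"
  by (simp add: fundamental_def)

lemma fundamental_in_ext_power: "fundamental n k \<in> ext_power {1..n} k"
  unfolding fundamental_def by (rule egen_word_in_ext_power) simp

text \<open>
  Only the last factor of \<open>\<epsilon>\<^sup>1 \<and> \<dots> \<and> \<epsilon>\<^sup>k\<close> is moved by \<open>D\<^sub>t\<close>: two consecutive factors
  contribute \<open>(\<epsilon>\<^sup>i + t D\<^sub>t \<epsilon>\<^sup>i\<^sup>+\<^sup>1) \<and> D\<^sub>t \<epsilon>\<^sup>i\<^sup>+\<^sup>1 = \<epsilon>\<^sup>i \<and> D\<^sub>t \<epsilon>\<^sup>i\<^sup>+\<^sup>1\<close>.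
\<close>

lemma D_t_fundamental: "D_t n (fundamental n (Suc k)) = fps_const (fundamental n k) * D_basis n (Suc k)"
proof (induction k)
  case 0
  then show ?case by (simp add: fundamental_def D_t_egen)
next
  case (Suc k)
  let ?D = "D_basis n (Suc (Suc k))"
  have "D_t n (fundamental n (Suc (Suc k)))
      = fps_const (fundamental n k) * ((fps_const (egen n (Suc k)) + fps_X * ?D) * ?D)"
    by (simp add: fundamental_Suc[of n "Suc k"] D_t_mult D_t_egen Suc.IH mult.assoc
        D_basis_shift[of "Suc k", symmetric])
  also have "(fps_const (egen n (Suc k)) + fps_X * ?D) * ?D = fps_const (egen n (Suc k)) * ?D"
    using alternating_D_basis[of n]
    by (simp add: alternating_on_basis_def distrib_right mult.assoc)
  finally show ?case by (simp add: fundamental_Suc mult.assoc[symmetric])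
qed

lemma D_op_fundamental: "D_op n h (fundamental n (Suc k)) = fundamental n k * egen n (Suc k + h)"
  by (simp add: D_op_def D_t_fundamental D_basis_nth)

text \<open>
  Let \<open>G\<close> be the set of all \<open>P(D) (\<epsilon>\<^sup>1 \<and> \<dots> \<and> \<epsilon>\<^sup>k\<^sup>+\<^sup>1)\<close>. The set of those \<open>y\<close> with \<open>k\<close> factors such that
  \<open>y \<and> \<epsilon>\<^sup>i \<in> G\<close> for all \<open>i\<close> contains \<open>\<epsilon>\<^sup>1 \<and> \<dots> \<and> \<epsilon>\<^sup>k\<close>, because \<open>\<epsilon>\<^sup>1 \<and> \<dots> \<and> \<epsilon>\<^sup>k \<and> \<epsilon>\<^sup>k\<^sup>+\<^sup>1\<^sup>+\<^sup>h\<close> is a value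
  of \<open>D\<^sub>h\<close>, and it is stable under the operators by integration by parts. By induction it is
  everything.
\<close>

lemma fundamental_generates:
  "z \<in> ext_power {1..n} k \<Longrightarrow> \<exists>P\<in>carrier (int_mpoly_ring {1..}). z = op_poly n P (fundamental n k)"
proof (induction k arbitrary: z)
  case 0
  show ?case
    using 0
  proof (induction rule: ext_power_induct)
    case (diff x y)
    then obtain P Q where "P \<in> carrier (int_mpoly_ring {1..})" "x = op_poly n P (fundamental n 0)"
      "Q \<in> carrier (int_mpoly_ring {1..})" "y = op_poly n Q (fundamental n 0)" by blast
    then show ?case
      by (intro bexI[of _ "P - Q"]) (simp_all add: D_op.eval_ops_diff int_mpoly_diff)
  next
    case (word xs)
    then show ?case by (intro bexI[of _ 1]) (simp_all add: fundamental_def)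
  qed (intro bexI[of _ 0]; simp)
next
  case (Suc k)
  define G where "G = (\<lambda>P. op_poly n P (fundamental n (Suc k))) ` carrier (int_mpoly_ring {1..})"
  have G_subset: "y \<in> ext_power {1..n} (Suc k)" if "y \<in> G" for y
    using that op_poly_in_ext_power[OF fundamental_in_ext_power] unfolding G_def by blast
  have G_diff: "x - y \<in> G" if "x \<in> G" "y \<in> G" for x y
  proof -
    obtain P Q where "P \<in> carrier (int_mpoly_ring {1..})" "x = op_poly n P (fundamental n (Suc k))"
      "Q \<in> carrier (int_mpoly_ring {1..})" "y = op_poly n Q (fundamental n (Suc k))"
      using \<open>x \<in> G\<close> \<open>y \<in> G\<close> unfolding G_def by blast
    then show ?thesis unfolding G_def
      by (intro image_eqI[of _ _ "P - Q"]) (simp_all add: D_op.eval_ops_diff int_mpoly_diff)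
  qed
  have G_D: "D_op n h y \<in> G" if "y \<in> G" for h y
  proof (cases "h = 0")
    case True
    then show ?thesis using that D_op_0[OF G_subset] by simp
  next
    case False
    obtain P where "P \<in> carrier (int_mpoly_ring {1..})" "y = op_poly n P (fundamental n (Suc k))"
      using \<open>y \<in> G\<close> unfolding G_def by blast
    then show ?thesis unfolding G_def using False
      by (intro image_eqI[of _ _ "mvar h * P"])
         (simp_all add: D_op.eval_ops_mvar_mult int_mpoly_mult int_mpoly_mvar)
  qed
  have G_fundamental: "fundamental n (Suc k) \<in> G"
    unfolding G_def by (rule image_eqI[of _ _ 1]) simp_all
  let ?S = "{y. \<forall>i\<ge>1. y * egen n i \<in> G}"
  have "y \<in> ?S" if y: "y \<in> ext_power {1..n} k" for y
  proof -
    obtain P where P: "P \<in> carrier (int_mpoly_ring {1..})" "y = op_poly n P (fundamental n k)"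
      using Suc.IH[OF y] by blast
    have "fundamental n k \<in> ?S"
    proof (intro CollectI allI impI)
      fix i :: nat assume "1 \<le> i"
      show "fundamental n k * egen n i \<in> G"
      proof (cases "i \<le> k")
        case True
        then have "\<not> distinct ([1..<Suc k] @ [i])" using \<open>1 \<le> i\<close> by auto
        then have "prod_list (map (egen n) ([1..<Suc k] @ [i])) = 0"
          by (simp only: egen_word word_not_distinct if_cancel not_False_eq_True)
        then have "fundamental n k * egen n i = 0" by (simp add: fundamental_def)
        then show ?thesis using G_diff[OF G_fundamental G_fundamental] by simp
      next
        case False
        then have "i = Suc k + (i - Suc k)" by simp
        then have "fundamental n k * egen n i = D_op n (i - Suc k) (fundamental n (Suc k))"
          by (simp add: D_op_fundamental)
        then show ?thesis using G_D[OF G_fundamental] by simp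
      qed
    qed
    then have "op_poly n P (fundamental n k) \<in> ?S"
    proof (rule D_op.eval_ops_closed[OF P(1)])
      fix y z assume "y \<in> ?S" "z \<in> ?S"
      then show "y - z \<in> ?S" by (simp add: left_diff_distrib G_diff)
    next
      fix h y assume y: "y \<in> ?S"
      show "D_op n h y \<in> ?S"
      proof (intro CollectI allI impI)
        fix i :: nat assume i: "1 \<le> i"
        have "D_op n h y * egen n i = D_op n h (y * egen n i) -
            (if h = 0 then 0 else D_op n (h - 1) (y * egen n (Suc i)))"
          by (simp add: D_op_mult_egen[OF i])
        moreover have "(if h = 0 then 0 else D_op n (h - 1) (y * egen n (Suc i))) \<in> G"
          using y G_D G_diff[OF G_fundamental G_fundamental] by simp
        ultimately show "D_op n h y * egen n i \<in> G"
          using y i G_D G_diff by simp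
      qed
    qed
    then show ?thesis using P(2) by simp
  qed
  with Suc.prems have "z \<in> G"
    by (induction rule: ext_power_Suc_induct) (auto intro: G_diff)
  then show ?case unfolding G_def by blast
qed

section \<open>The operators of higher index\<close>

lemma D_inv_convolution_poly:
  "(\<Sum>j = 0..m. D_inv j * fps_nth D_gen_series (m - j)) = (if m = 0 then 1 else 0)"
proof -
  have "Abs_fps D_inv * D_gen_series = 1"
    using D_gen_series_inverse by (simp add: mult.commute)
  then have "fps_nth (Abs_fps D_inv * D_gen_series) m = fps_nth 1 m" by simp
  then show ?thesis by (simp add: fps_mult_nth)
qed

lemma D_inv_convolution:
  assumes "z \<in> ext_power {1..n} k"
  shows "(\<Sum>j = 0..m. D_op n (m - j) (op_poly n (D_inv j) z)) = (if m = 0 then z else 0)"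
proof -
  have gen: "op_poly n (fps_nth D_gen_series i) y = D_op n i y" if "y \<in> ext_power {1..n} k" for i y
    using D_op_0[OF that] by (simp add: D_gen_series_def)
  have "(\<Sum>j = 0..m. op_poly n (D_inv j) (op_poly n (fps_nth D_gen_series (m - j)) z))
      = op_poly n (if m = 0 then 1 else 0) z"
    by (simp only: D_op.eval_ops_sum[symmetric] D_op.eval_ops_mult[symmetric] D_inv_convolution_poly)
  moreover have "op_poly n (D_inv j) (op_poly n (fps_nth D_gen_series i) z)
      = D_op n i (op_poly n (D_inv j) z)" for i j
    by (subst D_op.eval_ops_commute) (rule gen[OF op_poly_in_ext_power[OF assms]])
  ultimately show ?thesis by (simp split: if_splits)
qed

lemma D_inv_0: "D_inv 0 = 1"
  using arg_cong[OF D_gen_series_inverse, of "\<lambda>f. fps_nth f 0"] by (simp add: D_gen_series_def)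

text \<open>
  The inverse \<open>E\<^sub>t = \<Sum>\<^sub>j a\<^sub>j(D) t\<^sup>j\<close> of \<open>D\<^sub>t\<close> satisfies \<open>E\<^sub>t (x \<and> \<epsilon>\<^sup>i) = E\<^sub>t x \<and> (\<epsilon>\<^sup>i - t \<epsilon>\<^sup>i\<^sup>+\<^sup>1)\<close>:
  by integration by parts \<open>D\<^sub>t\<close> takes the right-hand side to \<open>x \<and> \<epsilon>\<^sup>i\<close>, and \<open>D\<^sub>t\<close> is injective.
\<close>

lemma D_inv_mult_egen:
  assumes x: "x \<in> ext_power {1..n} k" and i: "1 \<le> i"
  shows "op_poly n (D_inv m) (x * egen n i) = op_poly n (D_inv m) x * egen n i -
    (if m = 0 then 0 else op_poly n (D_inv (m - 1)) x * egen n (Suc i))"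
proof (induction m rule: less_induct)
  case (less m)
  define E where "E = (\<lambda>j. op_poly n (D_inv j))"
  define Y where "Y = (\<lambda>j. E j x * egen n i - (if j = 0 then 0 else E (j - 1) x * egen n (Suc i)))"
  let ?z = "x * egen n i"
  have E_in: "E j x \<in> ext_power {1..n} k" for j
    unfolding E_def by (rule op_poly_in_ext_power[OF x])
  have z_in: "?z \<in> ext_power {1..n} (Suc k)" by (rule mult_egen_in_ext_power[OF x])
  have Y_in: "Y j \<in> ext_power {1..n} (Suc k)" for j
    unfolding Y_def by (intro ext_power_diff) (simp_all only: mult_egen_in_ext_power E_in
        zero_in_ext_power split: if_split, simp_all)
  \<comment> \<open>The subtracted terms of \<open>Y\<close> cancel the correction terms of integration by parts.\<close>
  have shift: "(\<Sum>j = 0..m. D_op n (m - j) (if j = 0 then 0 else E (j - 1) x * egen n (Suc i)))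
      = (\<Sum>j = 0..m. if m - j = 0 then 0 else D_op n (m - j - 1) (E j x * egen n (Suc i)))"
  proof (cases m)
    case (Suc p)
    have "(\<Sum>j = 0..m. D_op n (m - j) (if j = 0 then 0 else E (j - 1) x * egen n (Suc i)))
        = (\<Sum>j = 0..p. D_op n (p - j) (E j x * egen n (Suc i)))"
      unfolding Suc by (subst sum.atLeast0_atMost_Suc_shift) simp
    also have "\<dots> = (\<Sum>j = 0..m. if m - j = 0 then 0 else D_op n (m - j - 1) (E j x * egen n (Suc i)))"
      unfolding Suc by (simp add: Suc_diff_le)
    finally show ?thesis .
  qed simp
  have "(\<Sum>j = 0..m. D_op n (m - j) (Y j)) = (\<Sum>j = 0..m. D_op n (m - j) (E j x) * egen n i)"
    by (simp add: Y_def D_op.D_diff sum_subtractf shift D_op_mult_egen[OF i] sum.distrib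
        del: D_op.D_zero)
  also have "\<dots> = (if m = 0 then ?z else 0)"
    unfolding sum_distrib_right[symmetric] E_def D_inv_convolution[OF x] by simp
  also have "\<dots> = (\<Sum>j = 0..m. D_op n (m - j) (E j ?z))"
    unfolding E_def D_inv_convolution[OF z_in] ..
  finally have "(\<Sum>j = 0..m. D_op n (m - j) (Y j)) = (\<Sum>j = 0..m. D_op n (m - j) (E j ?z))" .
  \<comment> \<open>By induction the two convolutions agree in all terms but the last, where \<open>D\<^sub>0\<close> is the identity.\<close>
  moreover have "(\<Sum>j\<in>{0..<m}. D_op n (m - j) (Y j)) = (\<Sum>j\<in>{0..<m}. D_op n (m - j) (E j ?z))"
    by (rule sum.cong) (use less.IH in \<open>simp_all add: Y_def E_def\<close>)
  ultimately have "D_op n 0 (Y m) = D_op n 0 (E m ?z)"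
    by (simp add: sum.last_plus)
  then have "Y m = E m ?z"
    using D_op_0[OF Y_in] D_op_0[OF op_poly_in_ext_power[OF z_in]] by (simp add: E_def)
  then show ?case by (simp only: Y_def E_def)
qed

text \<open>Each factor contributes at most one power of \<open>t\<close> to the inverse of \<open>D\<^sub>t\<close>.\<close>

lemma D_inv_vanishes:
  "z \<in> ext_power {1..n} k \<Longrightarrow> k < j \<Longrightarrow> op_poly n (D_inv j) z = 0"
proof (induction k arbitrary: z j)
  case 0
  have one: "1 \<in> ext_power {1..n} 0" using word_in_ext_power[of "[]" 0 "{1..n}"] by (simp del: One_nat_def)
  have unit: "op_poly n (D_inv j) 1 = 0" if "0 < j" for j
    using that
  proof (induction j rule: less_induct)
    case (less j)
    have "D_op n (j - i) (op_poly n (D_inv i) 1) = 0" if "i < j" for i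
      using that less.IH[of i] by (cases "i = 0") (simp_all add: D_inv_0 D_op_one)
    then have "(\<Sum>i = 0..j. D_op n (j - i) (op_poly n (D_inv i) 1))
        = D_op n 0 (op_poly n (D_inv j) 1)"
      by (simp add: sum.last_plus)
    then show ?case
      using D_inv_convolution[OF one, of j] D_op_0[OF op_poly_in_ext_power[OF one]] less.prems
      by simp
  qed
  show ?case
    using 0(1)
  proof (induction rule: ext_power_induct)
    case (word xs)
    then show ?case using unit 0(2) by simp
  qed (simp_all add: D_op.eval_ops_diff_right)
next
  case (Suc k)
  from Suc.prems(1) show ?case
  proof (induction rule: ext_power_Suc_induct)
    case (mult_egen x i)
    then show ?case using Suc.prems(2) by (simp add: D_inv_mult_egen Suc.IH)
  qed (simp add: D_op.eval_ops_diff_right)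
qed

text \<open>
  Hence on \<open>\<And>\<^sup>k M\<^sub>n\<close> the operators satisfy the recursion that defines \<open>D_sym\<close>.
\<close>

lemma op_poly_D_sym:
  assumes z: "z \<in> ext_power {1..n} k" and "0 \<le> h"
  shows "op_poly n (D_sym k h) z = D_op n (nat h) z"
  using assms(2)
proof (induction h rule: measure_induct_rule[where f = nat])
  case (less h)
  consider "h = 0" | "0 < h" "h \<le> int k" | "int k < h" using less.prems by linarith
  then show ?case
  proof cases
    case 1
    then show ?thesis using D_op_0[OF z] by (simp add: D_sym.simps[of k 0])
  next
    case 2
    then show ?thesis by (simp add: D_sym.simps[of k h])
  next
    case 3
    let ?m = "nat h"
    have m: "k < ?m" using 3 by simp
    have "op_poly n (D_sym k h) z = - (\<Sum>j = 1..k. op_poly n (D_inv j) (op_poly n (D_sym k (h - int j)) z))"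
      using 3 by (simp add: D_sym.simps[of k h] D_op.eval_ops_uminus D_op.eval_ops_sum D_op.eval_ops_mult)
    also have "\<dots> = - (\<Sum>j = 1..k. D_op n (?m - j) (op_poly n (D_inv j) z))"
    proof (intro arg_cong[where f = uminus] sum.cong refl)
      fix j assume j: "j \<in> {1..k}"
      then have "op_poly n (D_sym k (h - int j)) z = D_op n (?m - j) z"
        using 3 less.IH[of "h - int j"] by (simp add: nat_diff_distrib)
      then show "op_poly n (D_inv j) (op_poly n (D_sym k (h - int j)) z)
          = D_op n (?m - j) (op_poly n (D_inv j) z)"
        using D_op.eval_ops_commute[of n "D_inv j" "mvar (?m - j)" z] by simp
    qed
    also have "\<dots> = D_op n ?m z"
    proof -
      have split: "{0..?m} = insert 0 ({1..k} \<union> {Suc k..?m})" using m by auto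
      have "(\<Sum>j = 0..?m. D_op n (?m - j) (op_poly n (D_inv j) z))
          = D_op n ?m z + (\<Sum>j = 1..k. D_op n (?m - j) (op_poly n (D_inv j) z))
            + (\<Sum>j = Suc k..?m. D_op n (?m - j) (op_poly n (D_inv j) z))"
        unfolding split by (subst sum.insert) (auto simp: sum.union_disjoint D_inv_0 add.assoc)
      also have "(\<Sum>j = Suc k..?m. D_op n (?m - j) (op_poly n (D_inv j) z)) = 0"
        by (rule sum.neutral) (simp add: D_inv_vanishes[OF z])
      finally have "(\<Sum>j = 1..k. D_op n (?m - j) (op_poly n (D_inv j) z)) + D_op n ?m z = 0"
        using 3 unfolding D_inv_convolution[OF z] by (simp add: add.commute)
      then show ?thesis by (rule minus_unique)
    qed
    finally show ?thesis .
  qed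
qed

section \<open>The determinantal inverse\<close>

lemma D_sym_neg: "h < 0 \<Longrightarrow> D_sym k h = 0"
  by (simp add: D_sym.simps[of k h])

lemma D_sym_0 [simp]: "D_sym k 0 = 1"
  by (simp add: D_sym.simps[of k 0])

lemma D_sym_gen_series: "i \<le> k \<Longrightarrow> D_sym k (int i) = fps_nth D_gen_series i"
  by (simp add: D_sym.simps[of k "int i"] D_gen_series_def)

text \<open>For \<open>h \<le> k\<close> the recursion is the definition of the \<open>a\<^sub>j\<close>, because \<open>D\<^sub>j = 0\<close> for \<open>j < 0\<close>.\<close>

lemma D_sym_rec:
  assumes "0 < h"
  shows "D_sym k h = - (\<Sum>j = 1..k. D_inv j * D_sym k (h - int j))"
proof (cases "h \<le> int k")
  case True
  define m where "m = nat h"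
  have m: "h = int m" "0 < m" "m \<le> k" using assms True by (auto simp: m_def)
  have "(\<Sum>j = 1..k. D_inv j * D_sym k (h - int j)) = (\<Sum>j = 1..m. D_inv j * D_sym k (h - int j))"
    using m by (intro sum.mono_neutral_right) (auto simp: D_sym_neg)
  also have "\<dots> = (\<Sum>j = 1..m. D_inv j * fps_nth D_gen_series (m - j))"
  proof (rule sum.cong)
    fix j assume "j \<in> {1..m}"
    then have "h - int j = int (m - j)" "m - j \<le> k" using m by auto
    then show "D_inv j * D_sym k (h - int j) = D_inv j * fps_nth D_gen_series (m - j)"
      by (simp only: D_sym_gen_series)
  qed simp
  also have "D_sym k h + \<dots> = (\<Sum>j = 0..m. D_inv j * fps_nth D_gen_series (m - j))"
    using m by (simp add: sum.atLeast_Suc_atMost[of 0 m] D_inv_0 D_sym_gen_series)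
  finally have "(\<Sum>j = 1..k. D_inv j * D_sym k (h - int j)) + D_sym k h = 0"
    using m unfolding D_inv_convolution_poly by (simp add: add.commute)
  then show ?thesis by (rule minus_unique[symmetric])
next
  case False
  then show ?thesis by (simp add: D_sym.simps[of k h])
qed

lemma D_inv_in_carrier: "j \<le> k \<Longrightarrow> D_inv j \<in> carrier (int_mpoly_ring {1..k})"
proof (induction j rule: less_induct)
  case (less j)
  show ?case
  proof (cases "j = 0")
    case False
    have gen: "fps_nth D_gen_series i \<in> carrier (int_mpoly_ring {1..k})" if "i \<le> k" for i
      using that by (auto simp: D_gen_series_def intro: int_mpoly_mvar)
    have "(\<Sum>i\<in>{0..<j}. D_inv i * fps_nth D_gen_series (j - i)) + D_inv j = 0"
      using D_inv_convolution_poly[of j] False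
      by (simp add: sum.last_plus D_gen_series_def add.commute)
    then have "D_inv j = - (\<Sum>i\<in>{0..<j}. D_inv i * fps_nth D_gen_series (j - i))"
      by (rule minus_unique[symmetric])
    also have "\<dots> \<in> carrier (int_mpoly_ring {1..k})"
      by (intro int_mpoly_uminus int_mpoly_sum int_mpoly_mult gen) (use less in auto)
    finally show ?thesis .
  qed (simp add: D_inv_0)
qed

lemma D_sym_in_carrier: "D_sym k h \<in> carrier (int_mpoly_ring {1..k})"
proof (induction h rule: measure_induct_rule[where f = nat])
  case (less h)
  consider "h < 0" | "h = 0" | "0 < h" "h \<le> int k" | "int k < h" by linarith
  then show ?case
  proof cases
    case 3
    then show ?thesis by (simp add: D_sym.simps[of k h]) (rule int_mpoly_mvar, auto)
  next
    case 4
    then show ?thesis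
      by (subst D_sym_rec)
         (auto intro!: int_mpoly_uminus int_mpoly_sum int_mpoly_mult D_inv_in_carrier less
           simp del: One_nat_def)
  qed (simp_all add: D_sym_neg)
qed

text \<open>
  Row \<open>i\<close> of the Giambelli determinant is \<open>(D\<^sub>i\<^sub>-\<^sub>1, \<dots>, D\<^sub>i\<^sub>-\<^sub>k)\<close>; columns are counted from \<open>0\<close>.
\<close>

definition giambelli_row :: "nat \<Rightarrow> nat \<Rightarrow> nat \<Rightarrow> int_mpoly" where
  "giambelli_row k i b = D_sym k (int i - 1 - int b)"

definition giambelli :: "nat \<Rightarrow> nat list \<Rightarrow> int_mpoly" where
  "giambelli k = word_det k (giambelli_row k)"

lemma giambelli_det:
  "length xs = k \<Longrightarrow> giambelli k xs = det (mat k k (\<lambda>(a, b). giambelli_row k (xs ! a) b))"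
  by (simp add: giambelli_def word_det_def)

definition companion :: "nat \<Rightarrow> nat \<Rightarrow> int_mpoly" where
  "companion c b = (if b = 0 then - D_inv (Suc c) else if Suc c = b then 1 else 0)"

text \<open>
  The recursion says that raising the index by one multiplies the row by a fixed matrix.
\<close>

lemma giambelli_row_Suc:
  assumes "1 \<le> i" "b < k"
  shows "(\<Sum>c = 0..<k. giambelli_row k i c * companion c b) = giambelli_row k (Suc i) b"
proof (cases "b = 0")
  case True
  have "(\<Sum>c = 0..<k. giambelli_row k i c * companion c b)
      = - (\<Sum>c = 0..<k. D_inv (Suc c) * D_sym k (int i - int (Suc c)))"
    using True by (simp add: giambelli_row_def companion_def sum_negf algebra_simps)
  also have "\<dots> = - (\<Sum>j = 1..k. D_inv j * D_sym k (int i - int j))"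
    by (intro arg_cong[where f = uminus]
        sum.reindex_bij_witness[of _ "\<lambda>j. j - 1" Suc]) auto
  also have "\<dots> = D_sym k (int i)"
    using assms by (simp add: D_sym_rec[of "int i" k])
  finally show ?thesis using True by (simp add: giambelli_row_def)
next
  case False
  have "(\<Sum>c = 0..<k. giambelli_row k i c * companion c b)
      = (\<Sum>c = 0..<k. if c = b - 1 then giambelli_row k i c else 0)"
    using False by (intro sum.cong) (auto simp: companion_def)
  also have "\<dots> = giambelli_row k i (b - 1)" using assms by simp
  also have "\<dots> = giambelli_row k (Suc i) b"
    using False by (simp add: giambelli_row_def of_nat_diff)
  finally show ?thesis .
qed

definition row_series :: "nat \<Rightarrow> nat \<Rightarrow> nat \<Rightarrow> int_mpoly fps" where
  "row_series k i b = Abs_fps (\<lambda>j. giambelli_row k (i + j) b)"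

text \<open>
  The matrix of the word after \<open>D\<^sub>t\<close>: a letter \<open>i\<close> contributes the row \<open>\<Sum>\<^sub>j r(i + j) t\<^sup>j\<close>, where
  \<open>r(i)\<close> is its row in the Giambelli determinant.
\<close>

definition series_mat :: "nat \<Rightarrow> nat list \<Rightarrow> int_mpoly fps mat" where
  "series_mat k xs = mat k k (\<lambda>(a, b). row_series k (xs ! a) b)"

text \<open>The matrix \<open>1 - t C\<close>, where \<open>C\<close> takes each row to the next.\<close>

definition companion_mat :: "nat \<Rightarrow> int_mpoly fps mat" where
  "companion_mat k = mat k k
     (\<lambda>(c, b). (if c = b then 1 else 0) - fps_X * fps_const (companion c b))"

lemma row_series_companion:
  assumes "1 \<le> i" "b < k"
  shows "row_series k i b - (\<Sum>c = 0..<k. row_series k i c * (fps_X * fps_const (companion c b)))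
    = fps_const (giambelli_row k i b)"
proof (rule fps_ext)
  fix j
  have "fps_nth (row_series k i c * (fps_X * fps_const (companion c b))) j
      = (if j = 0 then 0 else giambelli_row k (i + (j - 1)) c * companion c b)" for c
    by (simp add: mult.assoc[symmetric] row_series_def)
  then have "fps_nth (\<Sum>c = 0..<k. row_series k i c * (fps_X * fps_const (companion c b))) j
      = (if j = 0 then 0 else giambelli_row k (i + j) b)"
    using assms by (simp add: fps_sum_nth giambelli_row_Suc del: fps_const_mult)
  then show "fps_nth (row_series k i b -
      (\<Sum>c = 0..<k. row_series k i c * (fps_X * fps_const (companion c b)))) j
      = fps_nth (fps_const (giambelli_row k i b)) j"
    by (simp add: row_series_def)
qed

lemma fps_const_hom: "comm_ring_hom (fps_const :: int_mpoly \<Rightarrow> int_mpoly fps)"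
  by unfold_locales (simp_all add: fps_const_add[symmetric] fps_const_mult[symmetric]
      del: fps_const_add fps_const_mult)

text \<open>
  Multiplying by \<open>1 - t C\<close> on the right telescopes each row series to its constant term.
\<close>

lemma det_series_mat_companion:
  assumes "length xs = k" "0 \<notin> set xs"
  shows "det (series_mat k xs) * det (companion_mat k) = fps_const (giambelli k xs)"
proof -
  interpret h: comm_ring_hom "fps_const :: int_mpoly \<Rightarrow> int_mpoly fps" by (rule fps_const_hom)
  have nz: "1 \<le> xs ! a" if "a < k" for a
    using assms that by (metis One_nat_def Suc_leI bot_nat_0.not_eq_extremum nth_mem)
  have "series_mat k xs * companion_mat k
      = map_mat fps_const (mat k k (\<lambda>(a, b). giambelli_row k (xs ! a) b))"
  proof (rule eq_matI)
    fix a b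
    assume "a < dim_row (map_mat fps_const (mat k k (\<lambda>(a, b). giambelli_row k (xs ! a) b)))"
      and "b < dim_col (map_mat fps_const (mat k k (\<lambda>(a, b). giambelli_row k (xs ! a) b)))"
    then have ab: "a < k" "b < k" by simp_all
    have "(series_mat k xs * companion_mat k) $$ (a, b)
        = (\<Sum>c = 0..<k. row_series k (xs ! a) c *
            (if c = b then 1 else 0) - row_series k (xs ! a) c * (fps_X * fps_const (companion c b)))"
      using ab by (simp add: series_mat_def companion_mat_def scalar_prod_def right_diff_distrib)
    also have "\<dots> = (\<Sum>c = 0..<k. if c = b then row_series k (xs ! a) c else 0) -
        (\<Sum>c = 0..<k. row_series k (xs ! a) c * (fps_X * fps_const (companion c b)))"
      unfolding sum_subtractf by (intro arg_cong2[where f = minus] sum.cong refl) simp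
    also have "\<dots> = fps_const (giambelli_row k (xs ! a) b)"
      using ab row_series_companion[OF nz[OF ab(1)] ab(2)] by simp
    finally show "(series_mat k xs * companion_mat k) $$ (a, b)
        = map_mat fps_const (mat k k (\<lambda>(a, b). giambelli_row k (xs ! a) b)) $$ (a, b)"
      using ab by simp
  qed (simp_all add: series_mat_def companion_mat_def)
  then have "det (series_mat k xs * companion_mat k)
      = fps_const (det (mat k k (\<lambda>(a, b). giambelli_row k (xs ! a) b)))"
    by simp
  then show ?thesis
    by (subst (asm) det_mult[of _ k])
       (simp_all add: giambelli_det assms series_mat_def companion_mat_def)
qed

lemma giambelli_fundamental: "giambelli k [1..<Suc k] = 1"
proof -
  let ?A = "mat k k (\<lambda>(a, b). giambelli_row k ([1..<Suc k] ! a) b)"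
  have A: "?A $$ (a, b) = D_sym k (int a - int b)" if "a < k" "b < k" for a b
    using that by (simp add: giambelli_row_def del: upt_Suc)
  have "det ?A = prod_list (diag_mat ?A)"
    by (rule det_lower_triangular[of k]) (simp_all only: A, auto simp: D_sym_neg)
  also have "\<dots> = 1"
    unfolding prod_list_diag_prod by (rule prod.neutral) (simp add: giambelli_row_def del: upt_Suc)
  finally show ?thesis by (simp add: giambelli_det del: upt_Suc)
qed

text \<open>
  On \<open>\<epsilon>\<^sup>1 \<and> \<dots> \<and> \<epsilon>\<^sup>k\<close> the determinant of the series is found as for the operators: subtracting \<open>t\<close>
  times the next row leaves the series only in the last row, and the matrix becomes triangular.
\<close>

lemma det_series_mat_fundamental:
  assumes "1 \<le> k"
  shows "det (series_mat k [1..<Suc k]) = Abs_fps (\<lambda>j. D_sym k (int j))"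
proof -
  let ?R = "series_mat k [1..<Suc k]"
  \<comment> \<open>Left multiplication by \<open>?U\<close> subtracts \<open>t\<close> times the next row from every row but the last.\<close>
  let ?U = "mat k k (\<lambda>(a, b). if a = b then 1 else if b = Suc a then - fps_X else 0) :: int_mpoly fps mat"
  let ?L = "mat k k (\<lambda>(a, b). if Suc a < k then fps_const (giambelli_row k (Suc a) b)
    else row_series k (Suc a) b)"
  have row_shift: "row_series k i b - fps_X * row_series k (Suc i) b = fps_const (giambelli_row k i b)"
    for i b by (rule fps_ext) (simp add: row_series_def)
  have "?U * ?R = ?L"
  proof (rule eq_matI)
    fix a b assume "a < dim_row ?L" "b < dim_col ?L"
    then have ab: "a < k" "b < k" by simp_all
    have "(?U * ?R) $$ (a, b)
        = (\<Sum>c = 0..<k. (if a = c then 1 else if c = Suc a then - fps_X else 0) * row_series k (Suc c) b)"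
      using ab by (simp add: series_mat_def scalar_prod_def del: upt_Suc)
    also have "\<dots> = (\<Sum>c = 0..<k. (if c = a then row_series k (Suc c) b else 0) +
        (if c = Suc a then - fps_X * row_series k (Suc c) b else 0))"
      by (rule sum.cong) auto
    also have "\<dots> = row_series k (Suc a) b +
        (if Suc a < k then - fps_X * row_series k (Suc (Suc a)) b else 0)"
      using ab by (simp add: sum.distrib)
    also have "\<dots> = ?L $$ (a, b)"
      using ab row_shift[of "Suc a" b] by simp
    finally show "(?U * ?R) $$ (a, b) = ?L $$ (a, b)" .
  qed (simp_all add: series_mat_def)
  moreover have "det ?U = 1"
  proof -
    have "det ?U = prod_list (diag_mat ?U)"
      by (rule det_upper_triangular[of _ k]) auto
    then show ?thesis unfolding prod_list_diag_prod by simp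
  qed
  moreover have "det ?L = Abs_fps (\<lambda>j. D_sym k (int j))"
  proof -
    have "det ?L = (\<Prod>a = 0..<k. ?L $$ (a, a))"
      by (subst det_lower_triangular[of k])
         (auto simp: prod_list_diag_prod giambelli_row_def D_sym_neg)
    also have "\<dots> = (\<Prod>a = 0..<k. if a = k - 1 then Abs_fps (\<lambda>j. D_sym k (int j)) else 1)"
      by (rule prod.cong) (auto simp: giambelli_row_def row_series_def)
    also have "\<dots> = Abs_fps (\<lambda>j. D_sym k (int j))" using assms by simp
    finally show ?thesis .
  qed
  moreover have "det (?U * ?R) = det ?U * det ?R"
    by (rule det_mult[of _ k]) (simp_all add: series_mat_def)
  ultimately show ?thesis by simp
qed

text \<open>
  The factor \<open>det (1 - t C)\<^sup>-\<^sup>1\<close> is the same for all words, hence is known from the word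
  \<open>[1, \<dots>, k]\<close>.
\<close>

lemma det_series_mat:
  assumes "length xs = k" "0 \<notin> set xs" "1 \<le> k"
  shows "det (series_mat k xs) = fps_const (giambelli k xs) * Abs_fps (\<lambda>j. D_sym k (int j))"
proof -
  have "det (series_mat k [1..<Suc k]) * det (companion_mat k) = 1"
    using det_series_mat_companion[of "[1..<Suc k]" k] by (simp add: giambelli_fundamental del: upt_Suc One_nat_def)
  then have inv: "det (companion_mat k) * Abs_fps (\<lambda>j. D_sym k (int j)) = 1"
    by (simp add: det_series_mat_fundamental[OF assms(3)] mult.commute del: upt_Suc One_nat_def)
  have "det (series_mat k xs)
      = det (series_mat k xs) * det (companion_mat k) * Abs_fps (\<lambda>j. D_sym k (int j))"
    by (simp add: mult.assoc inv)
  then show ?thesis by (simp only: det_series_mat_companion[OF assms(1,2)])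
qed

lemma fps_nth_signof_mult: "fps_nth (signof p * f) h = signof p * fps_nth f h"
  by (simp add: sign_def)

lemma det_series_mat_nth:
  assumes "length xs = k" "1 \<le> k"
  shows "fps_nth (det (series_mat k xs)) h = (\<Sum>v\<in>natpermute h k. giambelli k (map2 (+) xs v))"
proof -
  obtain m where k: "k = Suc m" using assms(2) by (cases k) auto
  let ?P = "{p. p permutes {0..<k}}"
  have "fps_nth (det (series_mat k xs)) h
      = (\<Sum>p\<in>?P. signof p * fps_nth (\<Prod>a = 0..<k. series_mat k xs $$ (a, p a)) h)"
    by (subst det_def'[of _ k]) (simp_all add: series_mat_def fps_sum_nth fps_nth_signof_mult)
  also have "\<dots> = (\<Sum>p\<in>?P. \<Sum>v\<in>natpermute h k.
      signof p * (\<Prod>a = 0..<k. giambelli_row k (map2 (+) xs v ! a) (p a)))"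
  proof (rule sum.cong[OF refl])
    fix p assume "p \<in> ?P"
    then have p: "p a < k" if "a < k" for a using permutes_in_image[of p "{0..<k}" a] that by simp
    have "fps_nth (\<Prod>a = 0..<k. series_mat k xs $$ (a, p a)) h
        = fps_nth (\<Prod>a = 0..m. row_series k (xs ! a) (p a)) h"
    proof (intro arg_cong[where f = "\<lambda>f. fps_nth f h"] prod.cong)
      show "{0..<k} = {0..m}" by (auto simp: k)
      fix a assume "a \<in> {0..m}"
      then have "a < k" "p a < k" using p by (simp_all add: k)
      then show "series_mat k xs $$ (a, p a) = row_series k (xs ! a) (p a)"
        by (simp add: series_mat_def)
    qed
    also have "\<dots> = (\<Sum>v\<in>natpermute h k. \<Prod>a = 0..m. giambelli_row k (xs ! a + v ! a) (p a))"
      unfolding fps_prod_nth by (simp add: k row_series_def)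
    also have "\<dots> = (\<Sum>v\<in>natpermute h k. \<Prod>a = 0..<k. giambelli_row k (map2 (+) xs v ! a) (p a))"
      by (intro sum.cong prod.cong) (use assms in \<open>auto simp: k natpermute_def\<close>)
    finally show "signof p * fps_nth (\<Prod>a = 0..<k. series_mat k xs $$ (a, p a)) h
        = (\<Sum>v\<in>natpermute h k.
            signof p * (\<Prod>a = 0..<k. giambelli_row k (map2 (+) xs v ! a) (p a)))"
      by (simp add: sum_distrib_left)
  qed
  also have "\<dots> = (\<Sum>v\<in>natpermute h k. \<Sum>p\<in>?P.
      signof p * (\<Prod>a = 0..<k. giambelli_row k (map2 (+) xs v ! a) (p a)))"
    by (rule sum.swap)
  also have "\<dots> = (\<Sum>v\<in>natpermute h k. giambelli k (map2 (+) xs v))"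
  proof (rule sum.cong[OF refl])
    fix v assume "v \<in> natpermute h k"
    then have len: "length (map2 (+) xs v) = k" using assms by (simp add: natpermute_def)
    have "signof p * (\<Prod>a = 0..<k. giambelli_row k (map2 (+) xs v ! a) (p a))
        = signof p * (\<Prod>a = 0..<k. mat k k (\<lambda>(a, b). giambelli_row k (map2 (+) xs v ! a) b) $$ (a, p a))"
      if "p permutes {0..<k}" for p
      using permutes_in_image[OF that]
      by (intro arg_cong2[where f = "(*)"] prod.cong refl) simp
    then show "(\<Sum>p\<in>?P. signof p * (\<Prod>a = 0..<k. giambelli_row k (map2 (+) xs v ! a) (p a)))
        = giambelli k (map2 (+) xs v)"
      unfolding giambelli_det[OF len] by (subst det_def'[of _ k]) simp_all
  qed
  finally show ?thesis .
qed

text \<open>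
  Pieri's rule, obtained by comparing the coefficients of \<open>t\<^sup>h\<close> in \<open>det_series_mat\<close>: the determinant
  of the series expands by multilinearity into the words with shifted letters.
\<close>

lemma giambelli_pieri:
  assumes "length xs = k" "0 \<notin> set xs" "1 \<le> k"
  shows "(\<Sum>v\<in>natpermute h k. giambelli k (map2 (+) xs v)) = giambelli k xs * D_sym k (int h)"
  unfolding det_series_mat_nth[OF assms(1,3), symmetric] det_series_mat[OF assms] by simp

section \<open>The ideal of relations\<close>

lemma ideal_D_ideal: "ideal (D_ideal n k) (int_mpoly_ring {1..k})"
proof -
  interpret cring "int_mpoly_ring {1..k}" by (rule cring_int_mpoly_ring)
  show ?thesis unfolding D_ideal_def by (rule genideal_ideal) (use D_sym_in_carrier in blast)
qed

lemma
  shows D_ideal_zero: "0 \<in> D_ideal n k"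
    and D_ideal_add: "p \<in> D_ideal n k \<Longrightarrow> q \<in> D_ideal n k \<Longrightarrow> p + q \<in> D_ideal n k"
    and D_ideal_mult: "p \<in> D_ideal n k \<Longrightarrow> q \<in> carrier (int_mpoly_ring {1..k}) \<Longrightarrow>
      q * p \<in> D_ideal n k"
proof -
  interpret ideal "D_ideal n k" "int_mpoly_ring {1..k}" by (rule ideal_D_ideal)
  show "0 \<in> D_ideal n k" using additive_subgroup.zero_closed[OF is_additive_subgroup] by simp
  show "p \<in> D_ideal n k \<Longrightarrow> q \<in> D_ideal n k \<Longrightarrow> p + q \<in> D_ideal n k"
    using additive_subgroup.a_closed[OF is_additive_subgroup] by simp
  show "p \<in> D_ideal n k \<Longrightarrow> q \<in> carrier (int_mpoly_ring {1..k}) \<Longrightarrow> q * p \<in> D_ideal n k"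
    using I_l_closed by simp
qed

lemma D_ideal_uminus: "p \<in> D_ideal n k \<Longrightarrow> - p \<in> D_ideal n k"
  using D_ideal_mult[of p n k "of_int (- 1)"] int_mpoly_of_int[of "- 1" "{1..k}"] by simp

lemma D_ideal_diff: "p \<in> D_ideal n k \<Longrightarrow> q \<in> D_ideal n k \<Longrightarrow> p - q \<in> D_ideal n k"
  using D_ideal_add[of p n k "- q"] D_ideal_uminus[of q n k] by simp

lemma D_ideal_sum: "(\<And>i. i \<in> I \<Longrightarrow> f i \<in> D_ideal n k) \<Longrightarrow> (\<Sum>i\<in>I. f i) \<in> D_ideal n k"
  by (induction I rule: infinite_finite_induct) (auto intro: D_ideal_zero D_ideal_add)

lemma D_ideal_gen:
  assumes "int n - int k + 1 \<le> h" "h \<le> int n" shows "D_sym k h \<in> D_ideal n k"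
proof -
  interpret cring "int_mpoly_ring {1..k}" by (rule cring_int_mpoly_ring)
  have "D_sym k ` {int n - int k + 1..int n} \<subseteq> D_ideal n k"
    unfolding D_ideal_def by (rule genideal_self) (use D_sym_in_carrier in blast)
  then show ?thesis using assms by auto
qed

text \<open>
  For \<open>k > n\<close> the generators include \<open>D\<^sub>0 = 1\<close>.
\<close>

lemma D_ideal_UNIV:
  assumes "n < k" "p \<in> carrier (int_mpoly_ring {1..k})" shows "p \<in> D_ideal n k"
  using D_ideal_mult[OF D_ideal_gen[of n k 0] assms(2)] assms(1) by simp

text \<open>
  The recursion of order \<open>k\<close> propagates membership from the \<open>k\<close> consecutive generators to all later
  indices.
\<close>

lemma D_sym_in_D_ideal: "int n - int k + 1 \<le> h \<Longrightarrow> D_sym k h \<in> D_ideal n k"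
proof (induction h rule: measure_induct_rule[where f = nat])
  case (less h)
  show ?case
  proof (cases "h \<le> int n \<or> n < k")
    case True
    then show ?thesis
    proof
      assume "h \<le> int n"
      with less.prems show ?thesis by (rule D_ideal_gen)
    next
      assume "n < k"
      then show ?thesis using D_sym_in_carrier by (rule D_ideal_UNIV)
    qed
  next
    case False
    then have h: "D_sym k h = - (\<Sum>j = 1..k. D_inv j * D_sym k (h - int j))"
      by (intro D_sym_rec) linarith
    have "D_inv j * D_sym k (h - int j) \<in> D_ideal n k" if "j \<in> {1..k}" for j
    proof (rule D_ideal_mult)
      show "D_sym k (h - int j) \<in> D_ideal n k"
        by (rule less.IH) (use False that in auto)
      show "D_inv j \<in> carrier (int_mpoly_ring {1..k})"
        by (rule D_inv_in_carrier) (use that in simp)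
    qed
    then show ?thesis unfolding h by (intro D_ideal_uminus D_ideal_sum)
  qed
qed

text \<open>
  The row of a letter \<open>i > n\<close> is \<open>(D\<^sub>i\<^sub>-\<^sub>1, \<dots>, D\<^sub>i\<^sub>-\<^sub>k)\<close>, with all indices at least \<open>n - k + 1\<close>.
\<close>

lemma giambelli_in_D_ideal:
  assumes "length xs = k" "\<not> set xs \<subseteq> {..n}"
  shows "giambelli k xs \<in> D_ideal n k"
proof -
  let ?A = "mat k k (\<lambda>(a, b). giambelli_row k (xs ! a) b)"
  obtain i where i: "i < k" "n < xs ! i"
    using assms by (metis atMost_iff in_set_conv_nth not_le_imp_less subsetI)
  have "signof p * (\<Prod>a = 0..<k. ?A $$ (a, p a)) \<in> D_ideal n k" if p: "p permutes {0..<k}" for p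
  proof -
    have A: "?A $$ (a, p a) = D_sym k (int (xs ! a) - 1 - int (p a))" if "a < k" for a
    proof -
      have "p a < k" using permutes_in_image[OF p, of a] that by simp
      then show ?thesis using that by (simp add: giambelli_row_def)
    qed
    have "p i < k" using permutes_in_image[OF p, of i] i by simp
    then have "?A $$ (i, p i) \<in> D_ideal n k"
      using i by (simp only: A) (intro D_sym_in_D_ideal, simp)
    moreover have "(\<Prod>a\<in>{0..<k} - {i}. ?A $$ (a, p a)) \<in> carrier (int_mpoly_ring {1..k})"
      by (intro int_mpoly_prod) (simp add: A D_sym_in_carrier del: index_mat One_nat_def)
    ultimately have "(\<Prod>a\<in>{0..<k} - {i}. ?A $$ (a, p a)) * ?A $$ (i, p i) \<in> D_ideal n k"
      by (rule D_ideal_mult)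
    also have "(\<Prod>a\<in>{0..<k} - {i}. ?A $$ (a, p a)) * ?A $$ (i, p i) = (\<Prod>a = 0..<k. ?A $$ (a, p a))"
      using i by (subst (2) prod.remove[of _ i]) (simp_all add: mult.commute del: index_mat)
    finally show ?thesis by (rule D_ideal_mult) (rule int_mpoly_of_int)
  qed
  then show ?thesis
    unfolding giambelli_det[OF assms(1)] by (subst det_def'[of _ k]) (auto intro!: D_ideal_sum)
qed

definition giambelli_map :: "nat \<Rightarrow> nat ext_alg \<Rightarrow> int_mpoly" where
  "giambelli_map k = ext_lin (giambelli k)"

lemma alternating_giambelli: "alternating_on_words (giambelli k)"
  unfolding giambelli_def by (rule alternating_word_det)

lemma
  shows giambelli_map_zero: "giambelli_map k 0 = 0"
    and giambelli_map_diff: "giambelli_map k (x - y) = giambelli_map k x - giambelli_map k y"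
    and giambelli_map_sum: "giambelli_map k (\<Sum>i\<in>I. f i) = (\<Sum>i\<in>I. giambelli_map k (f i))"
    and giambelli_map_word: "giambelli_map k (prod_list (map ext_gen xs)) = giambelli k xs"
  unfolding giambelli_map_def
  by (simp_all add: ext_lin_hom[OF alternating_giambelli] ext_lin_sum[OF alternating_giambelli])

text \<open>
  The operator drops the shifted words with a letter beyond \<open>n\<close>, which Pieri's rule retains; their
  determinants lie in the ideal.
\<close>

lemma giambelli_map_D_op:
  assumes k: "1 \<le> k" and z: "z \<in> ext_power {1..n} k"
  shows "giambelli_map k (D_op n h z) - D_sym k (int h) * giambelli_map k z \<in> D_ideal n k"
  using z
proof (induction rule: ext_power_induct)
  case (diff x y)
  have "giambelli_map k (D_op n h (x - y)) - D_sym k (int h) * giambelli_map k (x - y)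
      = (giambelli_map k (D_op n h x) - D_sym k (int h) * giambelli_map k x)
        - (giambelli_map k (D_op n h y) - D_sym k (int h) * giambelli_map k y)"
    by (simp add: D_op.D_diff giambelli_map_diff algebra_simps)
  then show ?case using diff by (simp add: D_ideal_diff)
next
  case (word xs)
  then have xs: "0 \<notin> set xs" "length xs = k" by auto
  have egen: "giambelli k ys - giambelli_map k (prod_list (map (egen n) ys)) \<in> D_ideal n k"
    if "length ys = k" "0 \<notin> set ys" for ys
  proof (cases "set ys \<subseteq> {1..n}")
    case True
    then have "prod_list (map (egen n) ys) = prod_list (map ext_gen ys)"
      by (simp only: egen_word if_True)
    then show ?thesis by (simp add: giambelli_map_word D_ideal_zero)
  next
    case False
    then have "\<not> set ys \<subseteq> {..n}" using that(2)
      by (metis One_nat_def Suc_leI atLeastAtMost_iff atMost_iff gr0I subset_iff)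
    moreover have "prod_list (map (egen n) ys) = 0"
      by (simp only: egen_word if_not_P[OF False])
    ultimately show ?thesis using that(1) by (simp add: giambelli_map_zero giambelli_in_D_ideal)
  qed
  have "(\<Sum>v\<in>natpermute h k. giambelli k (map2 (+) xs v) -
      giambelli_map k (prod_list (map (egen n) (map2 (+) xs v)))) \<in> D_ideal n k"
  proof (intro D_ideal_sum egen)
    fix v assume v: "v \<in> natpermute h k"
    then show "length (map2 (+) xs v) = k" using xs by (simp add: natpermute_def)
    show "0 \<notin> set (map2 (+) xs v)" using xs(1) by (auto dest: set_zip_leftD)
  qed
  also have "(\<Sum>v\<in>natpermute h k. giambelli k (map2 (+) xs v) -
      giambelli_map k (prod_list (map (egen n) (map2 (+) xs v))))
      = - (giambelli_map k (D_op n h (prod_list (map ext_gen xs)))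
          - D_sym k (int h) * giambelli_map k (prod_list (map ext_gen xs)))"
    by (simp add: sum_subtractf giambelli_pieri[OF xs(2,1) k] D_op_word[OF xs(1)] xs(2) giambelli_map_sum
        giambelli_map_word)
  finally show ?case using D_ideal_uminus by fastforce
qed (simp add: giambelli_map_zero D_ideal_zero)

lemma giambelli_map_op_poly:
  assumes k: "1 \<le> k" and P: "P \<in> carrier (int_mpoly_ring {1..k})"
    and z: "z \<in> ext_power {1..n} k"
  shows "giambelli_map k (op_poly n P z) - P * giambelli_map k z \<in> D_ideal n k"
  using P
proof (induction rule: int_mpoly_induct)
  case (const c)
  have "giambelli_map k (of_int c * z) = of_int c * giambelli_map k z"
    unfolding giambelli_map_def by (rule ext_lin_of_int[OF alternating_giambelli])
  then show ?case by (simp add: D_ideal_zero)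
next
  case (add p q)
  have "giambelli_map k (op_poly n (p + q) z)
      = giambelli_map k (op_poly n p z) + giambelli_map k (op_poly n q z)"
    unfolding giambelli_map_def by (simp add: D_op.eval_ops_add ext_lin_add[OF alternating_giambelli])
  then have "giambelli_map k (op_poly n (p + q) z) - (p + q) * giambelli_map k z
      = (giambelli_map k (op_poly n p z) - p * giambelli_map k z) +
        (giambelli_map k (op_poly n q z) - q * giambelli_map k z)"
    by (simp add: algebra_simps)
  then show ?case using add by (simp add: D_ideal_add)
next
  case (mvar i p)
  let ?w = "op_poly n p z"
  have i: "D_sym k (int i) = mvar i" using mvar(1) by (simp add: D_sym.simps[of k "int i"])
  have "giambelli_map k (D_op n i ?w) - mvar i * giambelli_map k ?w \<in> D_ideal n k"
    using giambelli_map_D_op[OF k op_poly_in_ext_power[OF z], of i p] i by simp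
  moreover have "mvar i * (giambelli_map k ?w - p * giambelli_map k z) \<in> D_ideal n k"
    by (rule D_ideal_mult[OF mvar(2) int_mpoly_mvar[OF mvar(1)]])
  ultimately have "(giambelli_map k (D_op n i ?w) - mvar i * giambelli_map k ?w) +
      mvar i * (giambelli_map k ?w - p * giambelli_map k z)
      \<in> D_ideal n k" by (rule D_ideal_add)
  then show ?case unfolding D_op.eval_ops_mvar_mult by (simp add: algebra_simps)
qed

lemma giambelli_map_fundamental: "k \<le> n \<Longrightarrow> giambelli_map k (fundamental n k) = 1"
proof -
  assume "k \<le> n"
  then have "set [1..<Suc k] \<subseteq> {1..n}" by auto
  then have "fundamental n k = prod_list (map ext_gen [1..<Suc k])"
    unfolding fundamental_def by (simp only: egen_word if_True)
  then show ?thesis by (simp only: giambelli_map_word giambelli_fundamental)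
qed

text \<open>
  For \<open>k \<le> n\<close> the determinant map inverts the evaluation at \<open>\<epsilon>\<^sup>1 \<and> \<dots> \<and> \<epsilon>\<^sup>k\<close> modulo the ideal.
\<close>

lemma annihilator_fundamental_subset:
  assumes "1 \<le> k" "P \<in> carrier (int_mpoly_ring {1..k})" "op_poly n P (fundamental n k) = 0"
  shows "P \<in> D_ideal n k"
proof (cases "n < k")
  case True
  then show ?thesis using assms(2) by (rule D_ideal_UNIV)
next
  case False
  then have "- P \<in> D_ideal n k"
    using giambelli_map_op_poly[OF assms(1,2) fundamental_in_ext_power[of n k]] assms(3)
    by (simp add: giambelli_map_zero giambelli_map_fundamental)
  then show ?thesis using D_ideal_uminus by fastforce
qed

text \<open>
  Such an operator kills \<open>\<epsilon>\<^sup>1 \<and> \<dots> \<and> \<epsilon>\<^sup>k\<close>, whose last factor would be moved beyond \<open>\<epsilon>\<^sup>n\<close>; it commutes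
  with the polynomials that generate everything else.
\<close>

lemma D_sym_annihilates:
  assumes "1 \<le> k" "z \<in> ext_power {1..n} k" "int n - int k + 1 \<le> h"
  shows "op_poly n (D_sym k h) z = 0"
proof (cases "h < 0")
  case False
  obtain l where l: "k = Suc l" using assms(1) by (cases k) auto
  have "n < Suc l + nat h" using assms(3) False l by linarith
  then have "egen n (Suc l + nat h) = 0" by (simp add: egen_def)
  then have "op_poly n (D_sym k h) (fundamental n k) = 0"
    using op_poly_D_sym[OF fundamental_in_ext_power, of h n k] False by (simp add: l D_op_fundamental)
  moreover obtain P where "z = op_poly n P (fundamental n k)" using fundamental_generates[OF assms(2)] by blast
  ultimately show ?thesis by (simp add: D_op.eval_ops_commute[of n "D_sym k h" P])
qed (simp add: D_sym_neg)

section \<open>The ring of endomorphisms\<close>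

abbreviation ext_End :: "nat \<Rightarrow> nat \<Rightarrow> (nat ext_alg \<Rightarrow> nat ext_alg) ring" where
  "ext_End n k \<equiv> End_ring (ext_power_module n k)"

lemma carrier_ext_End:
  "f \<in> carrier (ext_End n k) \<longleftrightarrow> f \<in> extensional (ext_power {1..n} k) \<and>
     (\<forall>x\<in>ext_power {1..n} k. f x \<in> ext_power {1..n} k) \<and>
     (\<forall>x\<in>ext_power {1..n} k. \<forall>y\<in>ext_power {1..n} k. f (x + y) = f x + f y)"
  by (auto simp: End_ring_def hom_def)

lemma ext_End_simps [simp]:
  "mult (ext_End n k) = compose (ext_power {1..n} k)"
  "one (ext_End n k) = (\<lambda>x\<in>ext_power {1..n} k. x)"
  "zero (ext_End n k) = (\<lambda>x\<in>ext_power {1..n} k. 0)"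
  "add (ext_End n k) = (\<lambda>f g. \<lambda>x\<in>ext_power {1..n} k. f x + g x)"
  by (simp_all add: End_ring_def)

lemma ring_ext_End: "ring (ext_End n k)"
proof -
  define L where "L = ext_power {1..n} k"
  have L: "x + y \<in> L" "- x \<in> L" "0 \<in> L" if "x \<in> L" "y \<in> L" for x y
    using that by (simp_all add: L_def ext_power_add ext_power_uminus)
  have zero: "0 \<in> L" by (simp add: L_def)
  have carr: "f \<in> carrier (ext_End n k) \<longleftrightarrow> f \<in> extensional L \<and> (\<forall>x\<in>L. f x \<in> L) \<and>
     (\<forall>x\<in>L. \<forall>y\<in>L. f (x + y) = f x + f y)" for f
    unfolding carrier_ext_End L_def ..
  have eqI: "f = g" if "f \<in> extensional L" "g \<in> extensional L" "\<And>x. x \<in> L \<Longrightarrow> f x = g x" for f g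
    using that by (rule extensionalityI)
  show ?thesis
  proof (rule ringI)
    show "abelian_group (ext_End n k)"
    proof (rule abelian_groupI)
      fix f g h
      assume f: "f \<in> carrier (ext_End n k)" and g: "g \<in> carrier (ext_End n k)"
      show "f \<oplus>\<^bsub>ext_End n k\<^esub> g \<in> carrier (ext_End n k)"
        using f g unfolding carr ext_End_simps L_def[symmetric] by (auto simp: L)
      show "f \<oplus>\<^bsub>ext_End n k\<^esub> g = g \<oplus>\<^bsub>ext_End n k\<^esub> f"
        unfolding ext_End_simps by (auto simp: add.commute)
      assume h: "h \<in> carrier (ext_End n k)"
      show "f \<oplus>\<^bsub>ext_End n k\<^esub> g \<oplus>\<^bsub>ext_End n k\<^esub> h = f \<oplus>\<^bsub>ext_End n k\<^esub> (g \<oplus>\<^bsub>ext_End n k\<^esub> h)"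
        unfolding ext_End_simps by (rule eqI[unfolded L_def]) (simp_all add: add.assoc)
    next
      show "\<zero>\<^bsub>ext_End n k\<^esub> \<in> carrier (ext_End n k)"
        unfolding carr ext_End_simps L_def[symmetric] by (auto simp: zero L)
    next
      fix f assume f: "f \<in> carrier (ext_End n k)"
      show "\<zero>\<^bsub>ext_End n k\<^esub> \<oplus>\<^bsub>ext_End n k\<^esub> f = f"
        using f unfolding carr ext_End_simps L_def[symmetric] by (intro eqI) auto
      have "(\<lambda>x\<in>L. - f x) \<in> carrier (ext_End n k)"
        using f unfolding carr by (auto simp: L)
      moreover have "(\<lambda>x\<in>L. - f x) \<oplus>\<^bsub>ext_End n k\<^esub> f = \<zero>\<^bsub>ext_End n k\<^esub>"
        unfolding ext_End_simps L_def[symmetric] by (intro eqI) auto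
      ultimately show "\<exists>g\<in>carrier (ext_End n k). g \<oplus>\<^bsub>ext_End n k\<^esub> f = \<zero>\<^bsub>ext_End n k\<^esub>" by blast
    qed
    show "monoid (ext_End n k)"
    proof (rule monoidI)
      fix f g h
      assume f: "f \<in> carrier (ext_End n k)" and g: "g \<in> carrier (ext_End n k)"
      show "f \<otimes>\<^bsub>ext_End n k\<^esub> g \<in> carrier (ext_End n k)"
        using f g unfolding carr ext_End_simps L_def[symmetric] by (auto simp: compose_def L)
      assume h: "h \<in> carrier (ext_End n k)"
      show "f \<otimes>\<^bsub>ext_End n k\<^esub> g \<otimes>\<^bsub>ext_End n k\<^esub> h = f \<otimes>\<^bsub>ext_End n k\<^esub> (g \<otimes>\<^bsub>ext_End n k\<^esub> h)"
        using f g h unfolding carr ext_End_simps L_def[symmetric]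
        by (intro eqI) (auto simp: compose_def)
    next
      show "\<one>\<^bsub>ext_End n k\<^esub> \<in> carrier (ext_End n k)"
        unfolding carr ext_End_simps L_def[symmetric] by (auto simp: L)
    next
      fix f assume f: "f \<in> carrier (ext_End n k)"
      show "\<one>\<^bsub>ext_End n k\<^esub> \<otimes>\<^bsub>ext_End n k\<^esub> f = f" "f \<otimes>\<^bsub>ext_End n k\<^esub> \<one>\<^bsub>ext_End n k\<^esub> = f"
        using f unfolding carr ext_End_simps L_def[symmetric]
        by (intro eqI; auto simp: compose_def)+
    qed
  next
    fix f g h
    assume f: "f \<in> carrier (ext_End n k)" and g: "g \<in> carrier (ext_End n k)"
      and h: "h \<in> carrier (ext_End n k)"
    show "(f \<oplus>\<^bsub>ext_End n k\<^esub> g) \<otimes>\<^bsub>ext_End n k\<^esub> h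
        = f \<otimes>\<^bsub>ext_End n k\<^esub> h \<oplus>\<^bsub>ext_End n k\<^esub> g \<otimes>\<^bsub>ext_End n k\<^esub> h"
      "h \<otimes>\<^bsub>ext_End n k\<^esub> (f \<oplus>\<^bsub>ext_End n k\<^esub> g)
        = h \<otimes>\<^bsub>ext_End n k\<^esub> f \<oplus>\<^bsub>ext_End n k\<^esub> h \<otimes>\<^bsub>ext_End n k\<^esub> g"
      using f g h unfolding carr ext_End_simps L_def[symmetric]
      by (intro eqI; auto simp: compose_def)+
  qed
qed

definition op_End :: "nat \<Rightarrow> nat \<Rightarrow> int_mpoly \<Rightarrow> nat ext_alg \<Rightarrow> nat ext_alg" where
  "op_End n k P = restrict (op_poly n P) (ext_power {1..n} k)"

lemma op_End_in_carrier: "op_End n k P \<in> carrier (ext_End n k)"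
  unfolding carrier_ext_End op_End_def
  by (simp add: op_poly_in_ext_power ext_power_add D_op.eval_ops_add_right del: One_nat_def)

lemma
  shows op_End_add: "op_End n k (P + Q) = op_End n k P \<oplus>\<^bsub>ext_End n k\<^esub> op_End n k Q"
    and op_End_mult: "op_End n k (P * Q) = op_End n k P \<otimes>\<^bsub>ext_End n k\<^esub> op_End n k Q"
    and op_End_one: "op_End n k 1 = \<one>\<^bsub>ext_End n k\<^esub>"
    and op_End_zero: "op_End n k 0 = \<zero>\<^bsub>ext_End n k\<^esub>"
    and op_End_mvar: "op_End n k (mvar i) = restrict (D_op n i) (ext_power {1..n} k)"
proof -
  show "op_End n k (P + Q) = op_End n k P \<oplus>\<^bsub>ext_End n k\<^esub> op_End n k Q"
    unfolding op_End_def ext_End_simps by (rule restrict_ext) (simp add: D_op.eval_ops_add)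
  show "op_End n k (P * Q) = op_End n k P \<otimes>\<^bsub>ext_End n k\<^esub> op_End n k Q"
    unfolding op_End_def ext_End_simps compose_def
    by (rule restrict_ext) (simp only: restrict_apply' D_op.eval_ops_mult op_poly_in_ext_power)
  show "op_End n k 1 = \<one>\<^bsub>ext_End n k\<^esub>" "op_End n k 0 = \<zero>\<^bsub>ext_End n k\<^esub>"
    "op_End n k (mvar i) = restrict (D_op n i) (ext_power {1..n} k)"
    unfolding op_End_def ext_End_simps by (rule restrict_ext, simp)+
qed

lemma op_End_uminus: "op_End n k (- P) = \<ominus>\<^bsub>ext_End n k\<^esub> op_End n k P"
proof -
  interpret ring "ext_End n k" by (rule ring_ext_End)
  have "op_End n k (- P) \<oplus>\<^bsub>ext_End n k\<^esub> op_End n k P = \<zero>\<^bsub>ext_End n k\<^esub>"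
    by (simp only: op_End_add[symmetric] op_End_zero[symmetric] left_minus)
  then show ?thesis using minus_equality op_End_in_carrier by metis
qed

lemma op_End_hom: "ring_hom_ring (int_mpoly_ring V) (ext_End n k) (op_End n k)"
proof (rule ring_hom_ringI2)
  show "ring (int_mpoly_ring V)" using cring_int_mpoly_ring by (rule cring.axioms)
  show "ring (ext_End n k)" by (rule ring_ext_End)
  show "op_End n k \<in> Ring.ring_hom (int_mpoly_ring V) (ext_End n k)"
    by (rule ring_hom_memI)
       (simp_all only: int_mpoly_ring_simps op_End_in_carrier op_End_add op_End_mult op_End_one)
qed

lemma op_End_kernel:
  assumes "1 \<le> k"
  shows "a_kernel (int_mpoly_ring {1..k}) (ext_End n k) (op_End n k) = D_ideal n k"
proof
  let ?R = "int_mpoly_ring {1..k}"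
  interpret h: ring_hom_ring ?R "ext_End n k" "op_End n k" by (rule op_End_hom)
  show "a_kernel ?R (ext_End n k) (op_End n k) \<subseteq> D_ideal n k"
  proof
    fix P assume "P \<in> a_kernel ?R (ext_End n k) (op_End n k)"
    then have P: "P \<in> carrier ?R" "op_End n k P = \<zero>\<^bsub>ext_End n k\<^esub>"
      unfolding a_kernel_def' by blast+
    have "op_End n k P (fundamental n k) = \<zero>\<^bsub>ext_End n k\<^esub> (fundamental n k)" by (simp only: P(2))
    then have "op_poly n P (fundamental n k) = 0"
      unfolding op_End_def ext_End_simps by (simp only: restrict_apply' fundamental_in_ext_power)
    then show "P \<in> D_ideal n k" by (rule annihilator_fundamental_subset[OF assms P(1)])
  qed
  have "D_sym k h \<in> a_kernel ?R (ext_End n k) (op_End n k)" if "h \<in> {int n - int k + 1..int n}" for h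
  proof -
    have "op_End n k (D_sym k h) = \<zero>\<^bsub>ext_End n k\<^esub>"
      unfolding op_End_def ext_End_simps
      by (rule restrict_ext) (rule D_sym_annihilates[OF assms], use that in simp_all)
    then show ?thesis unfolding a_kernel_def' using D_sym_in_carrier by blast
  qed
  then show "D_ideal n k \<subseteq> a_kernel ?R (ext_End n k) (op_End n k)"
    unfolding D_ideal_def by (intro h.R.genideal_minimal h.kernel_is_ideal) blast
qed

text \<open>
  The generators of index above \<open>k\<close> are in the image because they are values of \<open>D_sym\<close>.
\<close>

lemma op_End_image:
  "op_End n k ` carrier (int_mpoly_ring {1..k})
     = generate_ring (ext_End n k) {restrict (D_op n i) (ext_power {1..n} k) |i. 1 \<le> i}"
    (is "_ = generate_ring _ ?G")
proof
  interpret ring "ext_End n k" by (rule ring_ext_End)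
  show "op_End n k ` carrier (int_mpoly_ring {1..k}) \<subseteq> generate_ring (ext_End n k) ?G"
  proof clarify
    fix P assume "P \<in> carrier (int_mpoly_ring {1..k})"
    then show "op_End n k P \<in> generate_ring (ext_End n k) ?G"
    proof (induction rule: int_mpoly_induct)
      case (const c)
      have minus_one: "op_End n k (- 1) \<in> generate_ring (ext_End n k) ?G"
        unfolding op_End_uminus op_End_one by (intro generate_ring.intros)
      show ?case
      proof (induction c rule: int_induct[where k = 0])
        case base
        show ?case by (simp only: of_int_0 op_End_zero zero_in_generate)
      next
        case (step1 i)
        then show ?case
          by (simp only: of_int_add of_int_1 op_End_add op_End_one)
             (intro generate_ring.eng_add generate_ring.one)
      next
        case (step2 i)
        then show ?case
          by (simp only: diff_conv_add_uminus of_int_add of_int_minus of_int_1 op_End_add)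
             (intro generate_ring.eng_add minus_one)
      qed
    next
      case (add p q)
      then show ?case unfolding op_End_add by (rule generate_ring.eng_add)
    next
      case (mvar i p)
      then have "restrict (D_op n i) (ext_power {1..n} k) \<in> ?G" by auto
      then show ?case unfolding op_End_mult op_End_mvar
        using mvar(2) by (rule generate_ring.eng_mult[OF generate_ring.incl])
    qed
  qed
  show "generate_ring (ext_End n k) ?G \<subseteq> op_End n k ` carrier (int_mpoly_ring {1..k})"
  proof
    fix f assume "f \<in> generate_ring (ext_End n k) ?G"
    then show "f \<in> op_End n k ` carrier (int_mpoly_ring {1..k})"
    proof (induction rule: generate_ring.induct)
      case one
      show ?case unfolding op_End_one[symmetric] by (rule imageI) simp
    next
      case (incl f)
      then obtain i where f: "f = restrict (D_op n i) (ext_power {1..n} k)" by blast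
      have "f = op_End n k (D_sym k (int i))"
        unfolding f op_End_def by (rule restrict_ext) (simp only: op_poly_D_sym of_nat_0_le_iff nat_int)
      then show ?case using D_sym_in_carrier by blast
    next
      case (a_inv f)
      then obtain P where "P \<in> carrier (int_mpoly_ring {1..k})" "f = op_End n k P" by blast
      then show ?case by (simp only: op_End_uminus[symmetric]) (intro imageI int_mpoly_uminus)
    next
      case (eng_add f g)
      then obtain P Q where "P \<in> carrier (int_mpoly_ring {1..k})" "f = op_End n k P"
        "Q \<in> carrier (int_mpoly_ring {1..k})" "g = op_End n k Q" by blast
      then show ?case by (simp only: op_End_add[symmetric]) (intro imageI int_mpoly_add)
    next
      case (eng_mult f g)
      then obtain P Q where "P \<in> carrier (int_mpoly_ring {1..k})" "f = op_End n k P"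
        "Q \<in> carrier (int_mpoly_ring {1..k})" "g = op_End n k Q" by blast
      then show ?case by (simp only: op_End_mult[symmetric]) (intro imageI int_mpoly_mult)
    qed
  qed
qed

lemma intersection_pair_ext_power: "intersection_pair (ext_power_module n k) (D_op n)"
  unfolding intersection_pair_def
proof (intro conjI allI ballI)
  show "free_Z_module (ext_power_module n k)" by (rule free_ext_power_module)
  show "D_op n i \<in> hom (add_monoid (ext_power_module n k)) (add_monoid (ext_power_module n k))" for i
    by (rule homI) (simp_all add: D_op_in_ext_power D_op_add del: One_nat_def)
  show "D_op n i (D_op n j x) = D_op n j (D_op n i x)" for i j x by (rule D_op_commute)
  have "(\<lambda>P. poly_apply (ext_power_module n k) (D_op n) P (fundamental n k)) ` carrier (int_mpoly_ring {1..})
      = ext_power {1..n} k"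
    unfolding poly_apply_ext_power_module[OF fundamental_in_ext_power]
    using op_poly_in_ext_power[OF fundamental_in_ext_power] fundamental_generates by blast
  then show "\<exists>m0. fundamental_element (ext_power_module n k) (D_op n) m0"
    unfolding fundamental_element_def ext_power_module_simps using fundamental_in_ext_power by blast
qed

theorem proposition4p1:
  fixes n k :: nat
  assumes "n \<ge> 1" and "k \<ge> 1"
  shows "intersection_pair (ext_power_module n k) (D_op n) \<and>
    (\<exists>\<phi> \<in> ring_iso (int_mpoly_ring {1..k} Quot D_ideal n k)
                   (intersection_ring (ext_power_module n k) (D_op n)).
       \<forall>i\<in>{1..k}.
         \<phi> (D_ideal n k +>\<^bsub>int_mpoly_ring {1..k}\<^esub> mvar i)
           = restrict (D_op n i) (carrier (ext_power_module n k)))"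
proof (intro conjI bexI ballI)
  let ?R = "int_mpoly_ring {1..k}" and ?\<phi> = "\<lambda>X. the_elem (op_End n k ` X)"
  interpret h: ring_hom_ring ?R "ext_End n k" "op_End n k" by (rule op_End_hom)
  show "intersection_pair (ext_power_module n k) (D_op n)" by (rule intersection_pair_ext_power)
  have "intersection_ring (ext_power_module n k) (D_op n)
      = (ext_End n k)\<lparr>carrier := op_End n k ` carrier ?R\<rparr>"
    unfolding intersection_ring_def op_End_image by simp
  then show "?\<phi> \<in> ring_iso (?R Quot D_ideal n k) (intersection_ring (ext_power_module n k) (D_op n))"
    using h.FactRing_iso_set_aux unfolding op_End_kernel[OF assms(2)] by simp
  fix i assume "i \<in> {1..k}"
  then show "?\<phi> (D_ideal n k +>\<^bsub>?R\<^esub> mvar i) = restrict (D_op n i) (carrier (ext_power_module n k))"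
    using h.the_elem_simp[OF int_mpoly_mvar] unfolding op_End_kernel[OF assms(2)]
    by (simp add: op_End_mvar)
qed

end
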